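(* Let $X,U$ be Banach spaces, let $A:D(A)\to X$ generate a $C_0$-semigroup on $X$, and consider the system $\dot x(t)=Ax(t)+f(x(t),u(t))$ with $f:X\times U\to X$, $f(0,0)=0$ and $f(x,\cdot)$ continuous for every $x\in X$. Let $f$ and a function $V:X\to\mathbb{R}_+$ satisfy the following conditions: 1. $f$ is Lipschitz on bounded subsets of $X$, uniformly with respect to the second argument. 2. $A$ generates an analytic semigroup. 3. $V$ is Fréchet differentiable in $X$ and its derivative $\frac{\partial V}{\partial x}$ is bounded on bounded balls. 4. There exist $p\in\mathcal{K}$ and $q\in\mathcal{K}_\infty$ such that $\left|\frac{\partial V}{\partial x}(x)f(0,v)\right|\le p(\|x\|_X)+q(\|v\|_U)$ for all $x\in X$, $v\in U$. If $V$ is an ISS Lyapunov function in an implicative form for the system, then $V$ is also an ISS Lyapunov function in a dissipative form for the system. And if $V$ is an ISS Lyapunov function in a dissipative form for the system, then there exists an ISS Lyapunov function (possibly different from $V$) in an implicative form for the system.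
   Context: $\mathbb{R}_+=[0,\infty)$. Admissible inputs are $u\in U_c=C_b(\mathbb{R}_+,U)$, the bounded continuous functions $\mathbb{R}_+\to U$ with the supremum norm. Solutions are mild solutions: continuous $x$ with $x(t)=T(t)x(0)+\int_0^tT(t-s)f(x(s),u(s))\,ds$, where $\{T(t)\}_{t\ge0}$ is the semigroup generated by $A$; $\phi(t,\phi_0,u)$ is the state at time $t$ of the solution with initial condition $\phi_0$ at $t=0$ and input $u$. $f$ is Lipschitz on bounded subsets of $X$, uniformly w.r.t. the second argument, if for every $w>0$ there is $L(w)>0$ such that $\|f(y,v)-f(x,v)\|_X\le L(w)\|y-x\|_X$ for all $x,y$ with $\|x\|_X\le w$, $\|y\|_X\le w$ and all $v\in U$. Comparison functions: $\mathcal{P}$ = continuous $\gamma:\mathbb{R}_+\to\mathbb{R}_+$ with $\gamma(0)=0$ and $\gamma(r)>0$ for $r>0$; $\mathcal{K}$ = strictly increasing functions in $\mathcal{P}$; $\mathcal{K}_\infty$ = unbounded functions in $\mathcal{K}$. For continuous $V:X\to\mathbb{R}_+$, the Lie derivative is $\dot V_u(x)=\limsup_{t\to+0}\frac1t\bigl(V(\phi(t,x,u))-V(x)\bigr)$. ISS Lyapunov function in a dissipative form: a continuous $V:X\to\mathbb{R}_+$ for which there exist $\psi_1,\psi_2\in\mathcal{K}_\infty$, $\alpha\in\mathcal{P}$, $\sigma\in\mathcal{K}$ such that $\psi_1(\|x\|_X)\le V(x)\le\psi_2(\|x\|_X)$ for all $x\in X$, $\dot V_u(x)\le-\alpha(\|x\|_X)+\sigma(\|u(0)\|_U)$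 for all $x\in X$, $u\in U_c$, and moreover $\lim_{\tau\to\infty}\alpha(\tau)=\infty$ or $\liminf_{\tau\to\infty}\alpha(\tau)\ge\lim_{\tau\to\infty}\sigma(\tau)$. ISS Lyapunov function in an implicative form: a continuous $V:X\to\mathbb{R}_+$ for which there exist $\psi_1,\psi_2\in\mathcal{K}_\infty$, $\eta\in\mathcal{K}_\infty$, $\gamma\in\mathcal{K}$ such that $\psi_1(\|x\|_X)\le V(x)\le\psi_2(\|x\|_X)$ for all $x\in X$ and, for all $x\in X$ and $u\in U_c$, $\|x\|_X\ge\gamma(\|u(0)\|_U)$ implies $\dot V_u(x)\le-\eta(\|x\|_X)$. *)

theory Defs
  imports "HOL-Analysis.Analysis"
begin

section \<open>Semigroups and generators\<close>

definition C0_semigroup :: "(real \<Rightarrow> 'x::banach \<Rightarrow>\<^sub>L 'x) \<Rightarrow> bool" where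
  "C0_semigroup T \<longleftrightarrow>
     T 0 = id_blinfun \<and>
     (\<forall>s\<ge>0. \<forall>t\<ge>0. T (s + t) = T s o\<^sub>L T t) \<and>
     (\<forall>x. ((\<lambda>t. T t x) \<longlongrightarrow> x) (at_right 0))"

text \<open>An operator is given by its domain \<open>D\<close> and a function \<open>A\<close> that is relevant only on \<open>D\<close>.\<close>

definition generates :: "'x set \<Rightarrow> ('x \<Rightarrow> 'x) \<Rightarrow> (real \<Rightarrow> 'x::banach \<Rightarrow>\<^sub>L 'x) \<Rightarrow> bool" where
  "generates D A T \<longleftrightarrow>
     C0_semigroup T \<and>
     D = {x. \<exists>y. ((\<lambda>h. (T h x - x) /\<^sub>R h) \<longlongrightarrow> y) (at_right 0)} \<and>
     (\<forall>x\<in>D. ((\<lambda>h. (T h x - x) /\<^sub>R h) \<longlongrightarrow> A x) (at_right 0))"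

text \<open>
  Analyticity of a semigroup on a real Banach space refers to the complexification. It is
  realised on the product type, \<open>(x, y)\<close> standing for \<open>x + \<i> y\<close>. The product norm is equivalent
  to the usual complexification norms, and analyticity does not depend on this choice.
\<close>

lift_definition mult_i :: "('x::real_normed_vector \<times> 'x) \<Rightarrow>\<^sub>L ('x \<times> 'x)" is "\<lambda>p. (- snd p, fst p)"
  by (intro bounded_linear_Pair bounded_linear_minus bounded_linear_fst bounded_linear_snd)

definition sector :: "real \<Rightarrow> complex set" where
  "sector \<theta> = {z. z \<noteq> 0 \<and> \<bar>Arg z\<bar> < \<theta>}"

text \<open>
  Complex differentiability in the operator norm: the real derivative at \<open>z\<close> is multiplication
  of a fixed operator \<open>B\<close> by the complex increment \<open>h\<close>.
\<close>

definition operator_analytic_on ::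
    "(complex \<Rightarrow> ('x::banach \<times> 'x) \<Rightarrow>\<^sub>L ('x \<times> 'x)) \<Rightarrow> complex set \<Rightarrow> bool" where
  "operator_analytic_on S Z \<longleftrightarrow>
     (\<forall>z\<in>Z. \<exists>B. (S has_derivative (\<lambda>h. Re h *\<^sub>R B + Im h *\<^sub>R (mult_i o\<^sub>L B))) (at z))"

definition analytic_semigroup :: "(real \<Rightarrow> 'x::banach \<Rightarrow>\<^sub>L 'x) \<Rightarrow> bool" where
  "analytic_semigroup T \<longleftrightarrow>
     C0_semigroup T \<and>
     (\<exists>\<theta> S. 0 < \<theta> \<and> \<theta> \<le> pi / 2 \<and>
        (\<forall>z\<in>sector \<theta>. S z o\<^sub>L mult_i = mult_i o\<^sub>L S z) \<and>
        operator_analytic_on S (sector \<theta>) \<and>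
        S 0 = id_blinfun \<and>
        (\<forall>z\<in>sector \<theta>. \<forall>w\<in>sector \<theta>. S (z + w) = S z o\<^sub>L S w) \<and>
        (\<forall>p. ((\<lambda>z. S z p) \<longlongrightarrow> p) (at 0 within sector \<theta>)) \<and>
        (\<forall>t\<ge>0. \<forall>x y. S (complex_of_real t) (x, y) = (T t x, T t y)))"


section \<open>Mild solutions\<close>

text \<open>Inputs are total functions; their values at negative times are irrelevant.\<close>

definition admissible_inputs :: "(real \<Rightarrow> 'u::banach) set" where
  "admissible_inputs = {u. continuous_on {0..} u \<and> bounded (u ` {0..})}"

definition mild_solution ::
    "(real \<Rightarrow> 'x::banach \<Rightarrow>\<^sub>L 'x) \<Rightarrow> ('x \<Rightarrow> 'u::banach \<Rightarrow> 'x) \<Rightarrow> real \<Rightarrow> (real \<Rightarrow> 'u) \<Rightarrow> (real \<Rightarrow> 'x) \<Rightarrow> bool"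
  where
  "mild_solution T f \<tau> u x \<longleftrightarrow>
     continuous_on {0..\<tau>} x \<and>
     (\<forall>t\<in>{0..\<tau>}. x t = T t (x 0) + integral {0..t} (\<lambda>s. T (t - s) (f (x s) (u s))))"

text \<open>
  The state at time \<open>t\<close> of the solution starting at \<open>x\<^sub>0\<close>. Solutions need only exist locally in time;
  the value is unspecified beyond the maximal interval of existence.
\<close>

definition flow ::
    "(real \<Rightarrow> 'x::banach \<Rightarrow>\<^sub>L 'x) \<Rightarrow> ('x \<Rightarrow> 'u::banach \<Rightarrow> 'x) \<Rightarrow> real \<Rightarrow> 'x \<Rightarrow> (real \<Rightarrow> 'u) \<Rightarrow> 'x" where
  "flow T f t x\<^sub>0 u = (THE y. \<exists>x. mild_solution T f t u x \<and> x 0 = x\<^sub>0 \<and> x t = y)"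

definition lipschitz_on_bounded_uniformly :: "('x::banach \<Rightarrow> 'u::banach \<Rightarrow> 'x) \<Rightarrow> bool" where
  "lipschitz_on_bounded_uniformly f \<longleftrightarrow>
     (\<forall>w>0. \<exists>L>0. \<forall>x y. norm x \<le> w \<longrightarrow> norm y \<le> w \<longrightarrow>
        (\<forall>v. norm (f y v - f x v) \<le> L * norm (y - x)))"


section \<open>Comparison functions\<close>

text \<open>Functions on the half-line are total functions considered on \<open>{0..}\<close> only.\<close>

definition class_P :: "(real \<Rightarrow> real) set" where
  "class_P = {\<gamma>. continuous_on {0..} \<gamma> \<and> \<gamma> 0 = 0 \<and> (\<forall>r>0. \<gamma> r > 0)}"

definition class_K :: "(real \<Rightarrow> real) set" where
  "class_K = {\<gamma> \<in> class_P. strict_mono_on {0..} \<gamma>}"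

definition class_K_infinity :: "(real \<Rightarrow> real) set" where
  "class_K_infinity = {\<gamma> \<in> class_K. \<not> bounded (\<gamma> ` {0..})}"


section \<open>Lyapunov functions\<close>

text \<open>
  The Lie derivative takes values in the extended reals, because the difference quotients may be
  unbounded when \<open>x\<close> is not in the domain of the generator.
\<close>

definition lie_derivative ::
    "(real \<Rightarrow> 'x::banach \<Rightarrow>\<^sub>L 'x) \<Rightarrow> ('x \<Rightarrow> 'u::banach \<Rightarrow> 'x) \<Rightarrow> ('x \<Rightarrow> real) \<Rightarrow> (real \<Rightarrow> 'u) \<Rightarrow> 'x \<Rightarrow> ereal"
  where
  "lie_derivative T f V u x =
     Limsup (at_right 0) (\<lambda>t. ereal (1 / t * (V (flow T f t x u) - V x)))"

definition ISS_Lyapunov_dissipative ::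
    "(real \<Rightarrow> 'x::banach \<Rightarrow>\<^sub>L 'x) \<Rightarrow> ('x \<Rightarrow> 'u::banach \<Rightarrow> 'x) \<Rightarrow> ('x \<Rightarrow> real) \<Rightarrow> bool" where
  "ISS_Lyapunov_dissipative T f V \<longleftrightarrow>
     continuous_on UNIV V \<and> (\<forall>x. 0 \<le> V x) \<and>
     (\<exists>\<psi>\<^sub>1\<in>class_K_infinity. \<exists>\<psi>\<^sub>2\<in>class_K_infinity. \<exists>\<alpha>\<in>class_P. \<exists>\<sigma>\<in>class_K.
        (\<forall>x. \<psi>\<^sub>1 (norm x) \<le> V x \<and> V x \<le> \<psi>\<^sub>2 (norm x)) \<and>
        (\<forall>x. \<forall>u\<in>admissible_inputs.
           lie_derivative T f V u x \<le> ereal (- \<alpha> (norm x) + \<sigma> (norm (u 0)))) \<and>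
        (filterlim \<alpha> at_top at_top \<or>
         Liminf at_top (\<lambda>\<tau>. ereal (\<alpha> \<tau>)) \<ge> Lim at_top (\<lambda>\<tau>. ereal (\<sigma> \<tau>))))"

definition ISS_Lyapunov_implicative ::
    "(real \<Rightarrow> 'x::banach \<Rightarrow>\<^sub>L 'x) \<Rightarrow> ('x \<Rightarrow> 'u::banach \<Rightarrow> 'x) \<Rightarrow> ('x \<Rightarrow> real) \<Rightarrow> bool" where
  "ISS_Lyapunov_implicative T f V \<longleftrightarrow>
     continuous_on UNIV V \<and> (\<forall>x. 0 \<le> V x) \<and>
     (\<exists>\<psi>\<^sub>1\<in>class_K_infinity. \<exists>\<psi>\<^sub>2\<in>class_K_infinity. \<exists>\<eta>\<in>class_K_infinity. \<exists>\<gamma>\<in>class_K.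
        (\<forall>x. \<psi>\<^sub>1 (norm x) \<le> V x \<and> V x \<le> \<psi>\<^sub>2 (norm x)) \<and>
        (\<forall>x. \<forall>u\<in>admissible_inputs. norm x \<ge> \<gamma> (norm (u 0)) \<longrightarrow>
           lie_derivative T f V u x \<le> ereal (- \<eta> (norm x))))"

end

theory Submission
  imports Defs
begin

text \<open>
  Local existence and uniqueness of mild solutions give
  \<open>\<phi>(t, x, u) = T(t) x + t f(x, u(0)) + o(t)\<close> as \<open>t\<close> decreases to 0, for every state \<open>x\<close>.

  Implicative to dissipative: in the domain of the generator the Lie derivative is
  \<open>V'(x) (A x + f(x, u(0)))\<close>, hence it differs from the one for the input 0, which is at most
  \<open>- \<eta>(|x|)\<close>, by \<open>V'(x) (f(x, u(0)) - f(x, 0))\<close>. The Lipschitz condition and the bound on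
  \<open>V'(x) f(0, v)\<close> control this term by a function of \<open>|x|\<close> and \<open>|u(0)|\<close>. Analyticity carries the
  estimate over to all states, because \<open>T(t)\<close> maps into the domain for \<open>t > 0\<close>. The case
  \<open>|x| \<ge> \<gamma>(|u(0)|)\<close> is the implicative estimate itself, and in the other case \<open>|x|\<close> may be replaced
  by \<open>\<gamma>(|u(0)|)\<close>.

  Dissipative to implicative: let \<open>\<delta>\<close> be the running infimum of \<open>\<alpha>\<close>, and choose \<open>\<gamma>\<close> such that
  \<open>|x| \<ge> \<gamma>(|u(0)|)\<close> means \<open>\<sigma>(|u(0)|) \<le> \<delta>(|x|) |x| / (1 + |x|)\<close>. Then \<open>V\<close> decays at the rate
  \<open>\<delta>(|x|) / (1 + |x|)\<close>, and \<open>\<rho> \<circ> V\<close> with \<open>\<rho>' = (1 + \<psi>\<^sub>1\<^sup>-\<^sup>1)\<^sup>2\<close> decays at the unbounded rate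
  \<open>\<delta>(|x|) (1 + |x|)\<close>.
\<close>

section \<open>Strongly continuous semigroups near zero\<close>

text \<open>Baire's theorem: the closed sets \<open>E n\<close> cover a complete space, so one of
  them contains a ball, and linearity spreads the bound on that ball to all vectors.\<close>

lemma uniform_boundedness_principle:
  fixes F :: "('x::banach \<Rightarrow>\<^sub>L 'y::real_normed_vector) set"
  assumes "\<And>x. bounded ((\<lambda>S. blinfun_apply S x) ` F)"
  shows "bounded F"
proof -
  define E where "E n = {x. \<forall>S\<in>F. norm (blinfun_apply S x) \<le> real n}" for n
  have closed_E: "closed (E n)" for n
  proof -
    have "E n = (\<Inter>S\<in>F. {x. norm (blinfun_apply S x) \<le> real n})"
      by (auto simp: E_def)
    then show ?thesis
      by (auto intro!: closed_INT closed_Collect_le continuous_intros)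
  qed
  have cover: "(\<Union>n. E n) = UNIV"
  proof -
    have "\<exists>n. x \<in> E n" for x
    proof -
      obtain b where "\<forall>S\<in>F. norm (blinfun_apply S x) \<le> b"
        using assms[of x] by (auto simp: bounded_iff)
      moreover obtain n where "b \<le> real n"
        using real_arch_simple by blast
      ultimately show ?thesis
        by (auto simp: E_def intro: order_trans intro!: exI[of _ n])
    qed
    then show ?thesis by auto
  qed
  obtain n where "interior (E n) \<noteq> {}"
  proof (rule ccontr)
    assume "\<not> thesis"
    then have "interior (E n) = {}" for n
      using that by blast
    then have "interior (\<Union>(range E)) = {}"
      using Met_TC.metric_Baire_category_alt[of "range E"] closed_E
      by (auto simp: complete_UNIV)
    then show False
      using cover by simp
  qed
  then obtain c r where r: "0 < r" and ball: "ball c r \<subseteq> E n"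
    by (meson all_not_in_conv mem_interior)
  \<comment> \<open>\<open>y\<close> is rescaled to length \<open>r / 2\<close> so that
    \<open>c + z\<close> stays in the ball; \<open>S z\<close> is then a difference of two vectors
    of norm at most \<open>n\<close>, and undoing the scaling gives the constant.\<close>
  have "norm S \<le> 4 * real n / r" if "S \<in> F" for S
  proof (rule norm_blinfun_bound)
    fix y :: 'x
    show "norm (blinfun_apply S y) \<le> 4 * real n / r * norm y"
    proof (cases "y = 0")
      case False
      define z where "z = (r / (2 * norm y)) *\<^sub>R y"
      have "norm z = r / 2"
        using False r by (simp add: z_def)
      then have "c \<in> E n" "c + z \<in> E n"
        using ball r by (auto simp: dist_norm subset_iff)
      then have "norm (blinfun_apply S z) \<le> real n + real n"
        using that norm_triangle_ineq4[of "blinfun_apply S (c + z)" "blinfun_apply S c"]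
        by (fastforce simp: E_def blinfun.add_right)
      then have "r / (2 * norm y) * norm (blinfun_apply S y) \<le> 2 * real n"
        using r by (simp add: z_def blinfun.scaleR_right)
      then show ?thesis
        using r False by (simp add: field_simps)
    qed (simp add: blinfun.zero_right)
  qed (use r in auto)
  then show ?thesis
    unfolding bounded_iff by blast
qed

text \<open>Otherwise there are times \<open>s n\<close> tending to 0 from the right with norms
  above \<open>n\<close>; strong convergence bounds every sequence \<open>T (s n) x\<close>, against
  uniform boundedness.\<close>

lemma C0_semigroup_locally_bounded:
  assumes "C0_semigroup T"
  obtains h M where "0 < h" "1 \<le> M" "\<And>t. 0 \<le> t \<Longrightarrow> t \<le> h \<Longrightarrow> norm (T t) \<le> M"
proof -
  have lim: "((\<lambda>t. T t x) \<longlongrightarrow> x) (at_right 0)" for x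
    using assms by (auto simp: C0_semigroup_def)
  have "\<exists>n::nat. \<forall>t. 0 < t \<and> t < 1 / (Suc n) \<longrightarrow> norm (T t) \<le> real n"
  proof (rule ccontr)
    assume "\<not> ?thesis"
    then have "\<exists>t. 0 < t \<and> t < 1 / real (Suc n) \<and> real n < norm (T t)" for n :: nat
      by (meson not_le)
    then obtain s where s: "\<And>n. 0 < s n" "\<And>n. s n < 1 / real (Suc n)"
        "\<And>n. real n < norm (T (s n))"
      by metis
    have "s \<longlonglongrightarrow> 0"
      by (rule real_tendsto_sandwich[OF _ _ tendsto_const LIMSEQ_Suc[OF lim_1_over_n]])
         (use s in \<open>auto intro!: always_eventually less_imp_le\<close>)
    then have s0: "filterlim s (at_right 0) sequentially"
      using s(1) by (auto simp: filterlim_at intro!: always_eventually less_imp_neq[symmetric])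
    have "bounded ((\<lambda>S. blinfun_apply S x) ` range (\<lambda>n. T (s n)))" for x
      using convergent_imp_bounded[OF filterlim_compose[OF lim s0]] by (simp add: image_image)
    then have "bounded (range (\<lambda>n. T (s n)))"
      by (rule uniform_boundedness_principle)
    then obtain b where b: "\<And>n. norm (T (s n)) \<le> b"
      by (auto simp: bounded_iff)
    obtain n :: nat where "b < real n"
      using reals_Archimedean2 by blast
    then show False
      using s(3)[of n] b[of n] by linarith
  qed
  then obtain n where n: "\<And>t. 0 < t \<Longrightarrow> t < 1 / real (Suc n) \<Longrightarrow> norm (T t) \<le> real n"
    by blast
  show ?thesis
  proof
    \<comment> \<open>Halving turns the open interval into a closed one; adding 1 covers
      \<open>t = 0\<close> and makes the bound at least 1.\<close>
    show "0 < 1 / (2 * real (Suc n))" "1 \<le> 1 + real n"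
      by auto
    fix t :: real
    assume t: "0 \<le> t" "t \<le> 1 / (2 * real (Suc n))"
    show "norm (T t) \<le> 1 + real n"
    proof (cases "t = 0")
      case True
      have "norm (T 0) \<le> 1"
        using assms by (simp add: C0_semigroup_def norm_blinfun_id_le)
      then show ?thesis
        using True by simp
    next
      case False
      have "1 / (2 * real (Suc n)) < 1 / real (Suc n)"
        by (simp add: frac_less2)
      then have "norm (T t) \<le> real n"
        using False t by (intro n order.strict_trans1[of t "1 / (2 * real (Suc n))"]) auto
      then show ?thesis
        by simp
    qed
  qed
qed

text \<open>Lie derivatives involve only times close to 0, so the estimates are made on
  \<open>{0..h}\<close>, where one constant \<open>M\<close> bounds the semigroup.\<close>

locale C0_semigroup_near_0 =
  fixes T :: "real \<Rightarrow> 'x::banach \<Rightarrow>\<^sub>L 'x" and h M :: real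
  assumes C0: "C0_semigroup T"
    and h_pos: "0 < h" and M_ge_1: "1 \<le> M"
    and norm_T_le: "\<And>t. 0 \<le> t \<Longrightarrow> t \<le> h \<Longrightarrow> norm (T t) \<le> M"
begin

section \<open>Strong continuity and convolutions on a short time interval\<close>

lemma T_0 [simp]: "T 0 x = x"
  using C0 by (simp add: C0_semigroup_def)

lemma T_add: "0 \<le> s \<Longrightarrow> 0 \<le> t \<Longrightarrow> T (s + t) x = T s (T t x)"
  using C0 by (simp add: C0_semigroup_def)

lemma norm_T_apply_le: "0 \<le> t \<Longrightarrow> t \<le> h \<Longrightarrow> norm (T t x) \<le> M * norm x"
  using norm_blinfun[of "T t" x] norm_T_le[of t]
  by (meson mult_right_mono norm_ge_zero order_trans)

lemma tendsto_T_0: "((\<lambda>t. T t x) \<longlongrightarrow> x) (at_right 0)"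
  using C0 by (simp add: C0_semigroup_def)

text \<open>The semigroup law lets the operator at the smaller time be factored out, so right
  continuity at 0 yields two-sided continuity at every time.\<close>

lemma norm_T_diff_le:
  assumes "s \<in> {0..h}" "t \<in> {0..h}"
  shows "norm (T t x - T s x) \<le> M * norm (T \<bar>t - s\<bar> x - x)"
proof -
  have *: "norm (T t x - T s x) \<le> M * norm (T (t - s) x - x)"
    if "0 \<le> s" "s \<le> t" "t \<le> h" for s t
  proof -
    have "T t x - T s x = T s (T (t - s) x - x)"
      using T_add[of s "t - s" x] that by (simp add: blinfun.diff_right)
    then show ?thesis
      using norm_T_apply_le[of s "T (t - s) x - x"] that by simp
  qed
  show ?thesis
  proof (cases "s \<le> t")
    case True
    then show ?thesis using *[of s t] assms by simp
  next
    case False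
    then show ?thesis using *[of t s] assms by (simp add: norm_minus_commute)
  qed
qed

lemma continuous_on_T_apply: "continuous_on {0..h} (\<lambda>t. T t x)"
  unfolding continuous_on_iff
proof (intro ballI allI impI)
  fix s e :: real
  assume s: "s \<in> {0..h}" and "0 < e"
  then have "eventually (\<lambda>t. dist (T t x) x < e / M) (at_right 0)"
    using M_ge_1 tendsto_T_0 by (intro tendstoD) auto
  then obtain d where d: "0 < d" "\<And>t. 0 < t \<Longrightarrow> t < d \<Longrightarrow> dist (T t x) x < e / M"
    by (auto simp: eventually_at_right_field)
  show "\<exists>d>0. \<forall>t\<in>{0..h}. dist t s < d \<longrightarrow> dist (T t x) (T s x) < e"
  proof (intro exI conjI ballI impI)
    fix t
    assume t: "t \<in> {0..h}" "dist t s < d"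
    then have "norm (T \<bar>t - s\<bar> x - x) < e / M"
      using d(2)[of "\<bar>t - s\<bar>"] \<open>0 < e\<close> M_ge_1 by (cases "t = s") (auto simp: dist_norm)
    then have "M * norm (T \<bar>t - s\<bar> x - x) < e"
      using M_ge_1 by (simp add: field_simps)
    then show "dist (T t x) (T s x) < e"
      using norm_T_diff_le[OF s t(1), of x] by (simp add: dist_norm)
  qed (rule d)
qed

text \<open>\<open>y r\<close> is split into \<open>y s\<close> and \<open>y r - y s\<close>: the
  first part moves along a single orbit, the second is controlled by \<open>M\<close>. This makes
  convolution integrands continuous.\<close>

lemma continuous_on_T:
  assumes a: "continuous_on S a" and y: "continuous_on S y" and "a ` S \<subseteq> {0..h}"
  shows "continuous_on S (\<lambda>s. T (a s) (y s))"
proof -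
  have aS: "a s \<in> {0..h}" if "s \<in> S" for s
    using assms that by auto
  show ?thesis
    unfolding continuous_on_def
  proof
    fix s assume s: "s \<in> S"
    have "continuous_on S (\<lambda>r. T (a r) (y s))"
      by (rule continuous_on_compose2[OF continuous_on_T_apply a]) (use aS in auto)
    then have 1: "((\<lambda>r. T (a r) (y s)) \<longlongrightarrow> T (a s) (y s)) (at s within S)"
      using s by (simp add: continuous_on_def)
    have "((\<lambda>r. y r - y s) \<longlongrightarrow> 0) (at s within S)"
      using y s by (simp add: continuous_on_def LIM_zero)
    then have 2: "((\<lambda>r. T (a r) (y r - y s)) \<longlongrightarrow> 0) (at s within S)"
    proof (rule Lim_null_comparison[rotated, OF tendsto_mult_right_zero[OF tendsto_norm_zero]])
      show "eventually (\<lambda>r. norm (T (a r) (y r - y s)) \<le> M * norm (y r - y s)) (at s within S)"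
        unfolding eventually_at_filter
        by (rule always_eventually) (use aS norm_T_apply_le in force)
    qed
    show "((\<lambda>r. T (a r) (y r)) \<longlongrightarrow> T (a s) (y s)) (at s within S)"
      using tendsto_add[OF 1 2] by (simp add: blinfun.diff_right)
  qed
qed

text \<open>The substitution \<open>s = t * r\<close> moves \<open>t\<close> from the interval into
  the integrand and produces the factor \<open>t\<close> that difference quotients remove.\<close>

lemma convolution_eq_scaled_average:
  assumes t: "0 \<le> t"
  shows "integral {0..t} (\<lambda>s. T (t - s) (g s)) = t *\<^sub>R integral {0..1} (\<lambda>r. T (t * (1 - r)) (g (t * r)))"
proof (cases "t = 0")
  case False
  then have "(\<lambda>x. x / t) ` {0..t} = {0..1}"
    using t by (simp add: image_divide_atLeastAtMost)
  then show ?thesis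
    using integral_stretch_real[of t 0 t "\<lambda>s. T (t - s) (g s)"] False t
    by (simp add: right_diff_distrib)
qed simp

lemma continuous_on_average:
  assumes \<tau>: "\<tau> \<le> h" and g: "continuous_on {0..\<tau>} g"
  shows "continuous_on {0..\<tau>} (\<lambda>t. integral {0..1} (\<lambda>r. T (t * (1 - r)) (g (t * r))))"
proof -
  have box: "t * r \<in> {0..\<tau>}" "t * (1 - r) \<in> {0..h}" if "t \<in> {0..\<tau>}" "r \<in> {0..1}" for t r
    using that \<tau> mult_left_le[of r t] mult_left_le[of "1 - r" t] by auto
  have "continuous_on ({0..\<tau>} \<times> {0..1}) (\<lambda>p. T (fst p * (1 - snd p)) (g (fst p * snd p)))"
    using box
    by (intro continuous_on_T continuous_on_compose2[OF g] continuous_intros) auto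
  then show ?thesis
    using integral_continuous_on_param[of "{0..\<tau>}" 0 1 "\<lambda>t r. T (t * (1 - r)) (g (t * r))"]
    by (simp add: case_prod_unfold)
qed

lemma continuous_on_convolution:
  assumes "\<tau> \<le> h" and "continuous_on {0..\<tau>} g"
  shows "continuous_on {0..\<tau>} (\<lambda>t. integral {0..t} (\<lambda>s. T (t - s) (g s)))"
  by (rule continuous_on_eq[where f = "\<lambda>t. t *\<^sub>R integral {0..1} (\<lambda>r. T (t * (1 - r)) (g (t * r)))"])
     (auto intro!: continuous_intros continuous_on_average assms simp: convolution_eq_scaled_average)

text \<open>The quotient is the average over \<open>{0..1}\<close>, which is continuous in
  \<open>t\<close> and equals \<open>g 0\<close> at \<open>t = 0\<close>.\<close>

lemma convolution_quotient_tendsto: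
  assumes "0 < \<tau>" "\<tau> \<le> h" and g: "continuous_on {0..\<tau>} g"
  shows "((\<lambda>t. integral {0..t} (\<lambda>s. T (t - s) (g s)) /\<^sub>R t) \<longlongrightarrow> g 0) (at_right 0)"
proof -
  define K where "K t = integral {0..1} (\<lambda>r. T (t * (1 - r)) (g (t * r)))" for t
  have "continuous_on {0..\<tau>} K"
    unfolding K_def[abs_def] by (rule continuous_on_average[OF assms(2) g])
  then have "(K \<longlongrightarrow> K 0) (at 0 within {0..\<tau>})"
    using assms(1) by (simp add: continuous_on_def)
  moreover have "K 0 = g 0"
    by (simp add: K_def)
  ultimately have "(K \<longlongrightarrow> g 0) (at_right 0)"
    using assms(1) by (simp add: at_within_Icc_at_right)
  then show ?thesis
    by (rule Lim_transform_eventually)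
       (auto simp: eventually_at_right_field K_def convolution_eq_scaled_average intro!: exI[of _ 1])
qed

lemma integrable_convolution:
  assumes "t \<le> h" "continuous_on {0..t} g"
  shows "(\<lambda>s. T (t - s) (g s)) integrable_on {0..t}"
  using assms by (intro integrable_continuous_real continuous_on_T continuous_intros) auto

text \<open>The bound \<open>b\<close> may vary in time: a constant serves the contraction argument,
  an exponential the uniqueness proof.\<close>

lemma norm_convolution_diff_le:
  assumes t: "0 \<le> t" "t \<le> h" and g: "continuous_on {0..t} g" "continuous_on {0..t} g'"
    and B: "\<And>s. s \<in> {0..t} \<Longrightarrow> norm (g s - g' s) \<le> b s" and b: "continuous_on {0..t} b"
  shows "norm (integral {0..t} (\<lambda>s. T (t - s) (g s)) - integral {0..t} (\<lambda>s. T (t - s) (g' s)))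
    \<le> M * integral {0..t} b"
proof -
  have "norm (integral {0..t} (\<lambda>s. T (t - s) (g s) - T (t - s) (g' s))) \<le> integral {0..t} (\<lambda>s. M * b s)"
  proof (rule integral_norm_bound_integral)
    fix s assume s: "s \<in> {0..t}"
    have "norm (T (t - s) (g s - g' s)) \<le> M * norm (g s - g' s)"
      using s t by (intro norm_T_apply_le) auto
    also have "\<dots> \<le> M * b s"
      using B[OF s] M_ge_1 by simp
    finally show "norm (T (t - s) (g s) - T (t - s) (g' s)) \<le> M * b s"
      by (simp add: blinfun.diff_right)
  next
    show "(\<lambda>s. T (t - s) (g s) - T (t - s) (g' s)) integrable_on {0..t}"
      using t g by (intro integrable_diff integrable_convolution)
    show "(\<lambda>s. M * b s) integrable_on {0..t}"
      using b by (intro integrable_continuous_real continuous_on_mult_left)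
  qed
  then show ?thesis
    using t g by (subst integral_diff[symmetric]) (auto intro: integrable_convolution)
qed

end

section \<open>Local mild solutions\<close>

locale semilinear_system = C0_semigroup_near_0 T h M
  for T :: "real \<Rightarrow> 'x::banach \<Rightarrow>\<^sub>L 'x" and h M :: real +
  fixes f :: "'x \<Rightarrow> 'u::banach \<Rightarrow> 'x"
  assumes continuous_f: "\<And>x. continuous_on UNIV (f x)"
    and lipschitz_f: "lipschitz_on_bounded_uniformly f"
begin

lemma mild_solutionD:
  assumes "mild_solution T f \<tau> u x" "t \<in> {0..\<tau>}"
  shows "x t = T t (x 0) + integral {0..t} (\<lambda>s. T (t - s) (f (x s) (u s)))"
  using assms unfolding mild_solution_def by blast

lemma mild_solution_continuous: "mild_solution T f \<tau> u x \<Longrightarrow> continuous_on {0..\<tau>} x"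
  unfolding mild_solution_def by blast

lemma lipschitz_fE:
  assumes "0 < w"
  obtains L where "0 < L"
    "\<And>x y v. norm x \<le> w \<Longrightarrow> norm y \<le> w \<Longrightarrow> norm (f y v - f x v) \<le> L * norm (y - x)"
proof -
  obtain L where "0 < L" "\<forall>x y. norm x \<le> w \<longrightarrow> norm y \<le> w \<longrightarrow> (\<forall>v. norm (f y v - f x v) \<le> L * norm (y - x))"
    using lipschitz_f assms by (auto simp: lipschitz_on_bounded_uniformly_def)
  then show ?thesis
    by (intro that[of L]) auto
qed

text \<open>Continuity in the input at the fixed state \<open>x s\<close> handles one part; the
  Lipschitz bound, being uniform in the input, handles the change of state.\<close>

lemma continuous_on_f:
  assumes x: "continuous_on S x" and u: "continuous_on S u"
  shows "continuous_on S (\<lambda>s. f (x s) (u s))"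
  unfolding continuous_on_def
proof
  fix s assume s: "s \<in> S"
  obtain L where "0 < L" and L: "\<And>y z v. norm y \<le> norm (x s) + 1 \<Longrightarrow> norm z \<le> norm (x s) + 1 \<Longrightarrow>
      norm (f z v - f y v) \<le> L * norm (z - y)"
    by (rule lipschitz_fE[of "norm (x s) + 1"]) (auto simp: add_nonneg_pos)
  have x_lim: "(x \<longlongrightarrow> x s) (at s within S)"
    using x s by (simp add: continuous_on_def)
  have "continuous_on S (\<lambda>r. f (x s) (u r))"
    by (rule continuous_on_compose2[OF continuous_f u]) auto
  then have 1: "((\<lambda>r. f (x s) (u r)) \<longlongrightarrow> f (x s) (u s)) (at s within S)"
    using s by (simp add: continuous_on_def)
  have "eventually (\<lambda>r. norm (x r) < norm (x s) + 1) (at s within S)"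
    using tendsto_norm[OF x_lim] by (rule order_tendstoD) simp
  then have "eventually (\<lambda>r. norm (f (x r) (u r) - f (x s) (u r)) \<le> norm (x r - x s) * L) (at s within S)"
    by eventually_elim (use L in \<open>simp add: mult.commute\<close>)
  moreover have "((\<lambda>r. norm (x r - x s) * L) \<longlongrightarrow> 0) (at s within S)"
    by (intro tendsto_mult_left_zero tendsto_norm_zero LIM_zero x_lim)
  ultimately have 2: "((\<lambda>r. f (x r) (u r) - f (x s) (u r)) \<longlongrightarrow> 0) (at s within S)"
    by (rule Lim_null_comparison)
  show "((\<lambda>r. f (x r) (u r)) \<longlongrightarrow> f (x s) (u s)) (at s within S)"
    using tendsto_add[OF 1 2] by simp
qed

text \<open>Picard's argument: on a short interval the integral equation is a fixed point equation
  for a contraction of a closed ball of bounded continuous functions.\<close>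

lemma mild_solution_local_existence:
  assumes u: "continuous_on {0..h} u"
  obtains \<tau> x where "0 < \<tau>" "\<tau> \<le> h" "mild_solution T f \<tau> u x" "x 0 = x\<^sub>0"
proof -
  have f0: "continuous_on {0..h} (\<lambda>s. f 0 (u s))"
    by (rule continuous_on_f[OF continuous_on_const u])
  obtain K where K0: "0 \<le> K" and K: "\<And>s. s \<in> {0..h} \<Longrightarrow> norm (f 0 (u s)) \<le> K"
  proof -
    obtain K where "0 < K" "\<forall>y\<in>(\<lambda>s. f 0 (u s)) ` {0..h}. norm y \<le> K"
      using compact_imp_bounded[OF compact_continuous_image[OF f0 compact_Icc]]
      unfolding bounded_pos by blast
    then show ?thesis
      by (intro that[of K]) auto
  qed
  \<comment> \<open>\<open>M * norm x\<^sub>0\<close> bounds the free motion, and the extra 1 is the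
    room for the integral term.\<close>
  define R where "R = M * norm x\<^sub>0 + 1"
  have R: "1 \<le> R"
    using M_ge_1 by (simp add: R_def)
  obtain L where L0: "0 < L"
    and L: "\<And>x y v. norm x \<le> R \<Longrightarrow> norm y \<le> R \<Longrightarrow> norm (f y v - f x v) \<le> L * norm (y - x)"
    using lipschitz_fE[of R] R by auto
  \<comment> \<open>\<open>B\<close> bounds the nonlinearity on the ball of radius \<open>R\<close>
    and is at least \<open>L\<close>, so the single condition
    \<open>M * (\<tau> * B) \<le> 1 / 2\<close> gives both invariance of the ball and the
    contraction factor.\<close>
  define B where "B = L * R + K"
  have LB: "L \<le> B" and B0: "0 < B"
    using L0 K0 mult_left_mono[of 1 R L] R unfolding B_def by linarith+
  define \<tau> where "\<tau> = min h (1 / (2 * M * B))"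
  have \<tau>: "0 < \<tau>" "\<tau> \<le> h" and \<tau>B: "M * (\<tau> * B) \<le> 1 / 2"
  proof -
    show "0 < \<tau>" "\<tau> \<le> h"
      using h_pos M_ge_1 B0 by (auto simp: \<tau>_def)
    have "\<tau> \<le> 1 / (2 * M * B)"
      by (simp add: \<tau>_def)
    then show "M * (\<tau> * B) \<le> 1 / 2"
      using M_ge_1 B0 by (simp add: field_simps)
  qed
  have u\<tau>: "continuous_on {0..\<tau>} u"
    using u \<tau> by (auto intro: continuous_on_subset)
  define F where "F z t = T t x\<^sub>0 + integral {0..t} (\<lambda>s. T (t - s) (f (z s) (u s)))" for z t
  have g: "continuous_on {0..t} (\<lambda>s. f (apply_bcontfun z s) (u s))" if "t \<le> \<tau>" for z t
    using that by (intro continuous_on_f continuous_on_subset[OF u\<tau>]) auto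
  have "continuous_on (cbox 0 \<tau>) (F z)" for z :: "real \<Rightarrow>\<^sub>C 'x"
    using \<tau> unfolding F_def[abs_def]
    by (auto intro!: continuous_intros continuous_on_convolution g
        continuous_on_subset[OF continuous_on_T_apply])
  \<comment> \<open>Elements of the function space live on the whole line, so \<open>F z\<close> is
    extended from \<open>{0..\<tau>}\<close> by its end values.\<close>
  then have "\<exists>y::real \<Rightarrow>\<^sub>C 'x. \<forall>t. y t = F z (clamp 0 \<tau> t)" for z :: "real \<Rightarrow>\<^sub>C 'x"
    by (metis continuous_on_cbox_bcontfunE)
  then obtain \<Phi> :: "(real \<Rightarrow>\<^sub>C 'x) \<Rightarrow> (real \<Rightarrow>\<^sub>C 'x)"
    where \<Phi>: "\<And>z t. \<Phi> z t = F z (clamp 0 \<tau> t)"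
    by metis
  have clamp: "clamp 0 \<tau> t \<in> {0..\<tau>}" for t :: real
    using clamp_in_interval[of 0 \<tau> t] \<tau> by auto
  have "\<exists>!z\<in>cball 0 R. \<Phi> z = z"
  proof (rule Banach_fix)
    show "\<Phi> ` cball 0 R \<subseteq> cball 0 R"
    proof safe
      fix z :: "real \<Rightarrow>\<^sub>C 'x"
      assume "z \<in> cball 0 R"
      then have z: "norm (z s) \<le> R" for s
        using norm_bounded[of z s] by simp
      have "norm (F z t) \<le> R" if t: "t \<in> {0..\<tau>}" for t
      proof -
        have "norm (integral {0..t} (\<lambda>s. T (t - s) (f (z s) (u s))) - integral {0..t} (\<lambda>s. T (t - s) 0))
          \<le> M * integral {0..t} (\<lambda>s. B)"
        proof (rule norm_convolution_diff_le)
          fix s assume "s \<in> {0..t}"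
          then have "norm (f (z s) (u s) - f 0 (u s)) \<le> L * R" "norm (f 0 (u s)) \<le> K"
            using L[of 0 "z s" "u s"] z[of s] L0 R K t \<tau>
            by (auto intro: order_trans[OF _ mult_left_mono])
          then show "norm (f (z s) (u s) - 0) \<le> B"
            unfolding B_def using norm_triangle_ineq2[of "f (z s) (u s)" "f 0 (u s)"] by simp
        qed (use t \<tau> g in auto)
        also have "\<dots> \<le> M * (\<tau> * B)"
          using t B0 M_ge_1 by (auto intro!: mult_mono)
        finally have "norm (integral {0..t} (\<lambda>s. T (t - s) (f (z s) (u s)))) \<le> 1"
          using \<tau>B by (simp add: blinfun.zero_right)
        moreover have "norm (T t x\<^sub>0) \<le> M * norm x\<^sub>0"
          using t \<tau> by (intro norm_T_apply_le) auto
        ultimately show ?thesis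
          unfolding F_def R_def by (intro norm_triangle_le add_mono)
      qed
      then have "norm (\<Phi> z) \<le> R"
        using clamp by (intro norm_bound) (simp add: \<Phi>)
      then show "\<Phi> z \<in> cball 0 R"
        by simp
    qed
    fix z z' :: "real \<Rightarrow>\<^sub>C 'x"
    assume "z \<in> cball 0 R" "z' \<in> cball 0 R"
    then have z: "norm (z s) \<le> R" "norm (z' s) \<le> R" for s
      using norm_bounded[of z s] norm_bounded[of z' s] by auto
    have "dist (F z t) (F z' t) \<le> 1 / 2 * dist z z'" if t: "t \<in> {0..\<tau>}" for t
    proof -
      have "norm (integral {0..t} (\<lambda>s. T (t - s) (f (z s) (u s))) -
          integral {0..t} (\<lambda>s. T (t - s) (f (z' s) (u s)))) \<le> M * integral {0..t} (\<lambda>s. B * dist z z')"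
      proof (rule norm_convolution_diff_le)
        fix s
        have "norm (f (z s) (u s) - f (z' s) (u s)) \<le> L * dist (z s) (z' s)"
          using L z by (simp add: dist_norm)
        also have "\<dots> \<le> B * dist z z'"
          using L0 LB by (intro mult_mono dist_bounded) auto
        finally show "norm (f (z s) (u s) - f (z' s) (u s)) \<le> B * dist z z'" .
      qed (use t \<tau> g in auto)
      also have "\<dots> \<le> M * (\<tau> * (B * dist z z'))"
        using t B0 M_ge_1 by (auto intro!: mult_mono)
      also have "\<dots> = M * (\<tau> * B) * dist z z'"
        by simp
      also have "\<dots> \<le> 1 / 2 * dist z z'"
        using \<tau>B by (intro mult_right_mono) auto
      finally show ?thesis
        by (simp add: F_def dist_norm)
    qed
    then show "dist (\<Phi> z) (\<Phi> z') \<le> 1 / 2 * dist z z'"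
      using clamp by (intro dist_bound) (simp add: \<Phi>)
  qed (use R in \<open>auto simp: complete_eq_closed\<close>)
  then obtain z where z: "\<Phi> z = z"
    by blast
  have zF: "z t = F z t" if "t \<in> {0..\<tau>}" for t
    using \<Phi>[of z t] that z by simp
  have "mild_solution T f \<tau> u z"
    unfolding mild_solution_def using zF zF[of 0] \<tau> by (auto simp: F_def)
  then show ?thesis
    using that \<tau> zF[of 0] by (simp add: F_def)
qed

text \<open>Gronwall's inequality in the form of a weighted supremum: the weight \<open>exp (- \<kappa> s)\<close> makes the
  difference of two solutions at most half of itself.\<close>

lemma mild_solution_unique:
  assumes x: "mild_solution T f t u x" and y: "mild_solution T f t u y" and init: "x 0 = y 0"
    and t: "0 \<le> t" "t \<le> h" and u: "continuous_on {0..t} u" and r: "r \<in> {0..t}"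
  shows "x r = y r"
proof -
  have cx: "continuous_on {0..t} x" and cy: "continuous_on {0..t} y"
    using x y by (auto dest: mild_solution_continuous)
  have "bounded (x ` {0..t} \<union> y ` {0..t})"
    using cx cy by (auto intro!: compact_imp_bounded compact_continuous_image)
  then obtain R where R: "0 < R" "\<And>s. s \<in> {0..t} \<Longrightarrow> norm (x s) \<le> R \<and> norm (y s) \<le> R"
    unfolding bounded_pos by auto
  obtain L where L0: "0 < L"
    and L: "\<And>a b v. norm a \<le> R \<Longrightarrow> norm b \<le> R \<Longrightarrow> norm (f b v - f a v) \<le> L * norm (b - a)"
    using lipschitz_fE[of R] R by auto
  \<comment> \<open>Chosen so that \<open>M * L / \<kappa>\<close>, the factor left after
    integrating the exponential, is one half.\<close>
  define \<kappa> where "\<kappa> = 2 * M * L"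
  have \<kappa>: "0 < \<kappa>"
    using M_ge_1 L0 by (simp add: \<kappa>_def)
  define d where "d s = exp (- \<kappa> * s) * norm (x s - y s)" for s
  have "continuous_on {0..t} d"
    unfolding d_def[abs_def] by (intro continuous_intros cx cy)
  then obtain s where s: "s \<in> {0..t}" and max: "\<And>r. r \<in> {0..t} \<Longrightarrow> d r \<le> d s"
    using continuous_attains_sup[of "{0..t}" d] t by auto
  have norm_le: "norm (x r - y r) \<le> d s * exp (\<kappa> * r)" if "r \<in> {0..t}" for r
    using max[OF that] by (simp add: d_def exp_minus field_simps)
  have cs: "continuous_on {0..s} x" "continuous_on {0..s} y" "continuous_on {0..s} u"
    using s by (auto intro: continuous_on_subset[OF cx] continuous_on_subset[OF cy] continuous_on_subset[OF u])
  have "norm (x s - y s) \<le> M * integral {0..s} (\<lambda>r. L * d s * exp (\<kappa> * r))"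
  proof -
    have "x s - y s = integral {0..s} (\<lambda>r. T (s - r) (f (x r) (u r)))
        - integral {0..s} (\<lambda>r. T (s - r) (f (y r) (u r)))"
      by (simp only: mild_solutionD[OF x s] mild_solutionD[OF y s] init add_diff_cancel_left)
    moreover have "norm (integral {0..s} (\<lambda>r. T (s - r) (f (x r) (u r)))
        - integral {0..s} (\<lambda>r. T (s - r) (f (y r) (u r)))) \<le> M * integral {0..s} (\<lambda>r. L * d s * exp (\<kappa> * r))"
    proof (rule norm_convolution_diff_le)
      fix r assume "r \<in> {0..s}"
      then have r: "r \<in> {0..t}"
        using s by auto
      have "norm (f (x r) (u r) - f (y r) (u r)) \<le> L * norm (x r - y r)"
        using R(2)[OF r] L by simp
      also have "\<dots> \<le> L * (d s * exp (\<kappa> * r))"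
        using norm_le[OF r] L0 by simp
      finally show "norm (f (x r) (u r) - f (y r) (u r)) \<le> L * d s * exp (\<kappa> * r)"
        by (simp add: mult.assoc)
    qed (use s t cs in \<open>auto intro!: continuous_on_f continuous_intros\<close>)
    ultimately show ?thesis
      by simp
  qed
  also have "integral {0..s} (\<lambda>r. L * d s * exp (\<kappa> * r)) =
      L * d s / \<kappa> * exp (\<kappa> * s) - L * d s / \<kappa> * exp (\<kappa> * 0)"
    using s \<kappa>
    by (intro integral_unique fundamental_theorem_of_calculus)
       (auto intro!: derivative_eq_intros simp flip: has_real_derivative_iff_has_vector_derivative)
  also have "M * \<dots> = d s / 2 * exp (\<kappa> * s) - d s / 2"
    using M_ge_1 L0 by (simp add: \<kappa>_def field_simps)
  also have "\<dots> = norm (x s - y s) / 2 - d s / 2"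
    by (simp add: d_def exp_minus)
  \<comment> \<open>The lower limit of the integral contributed \<open>- d s / 2\<close>, which
    excludes a positive maximum \<open>d s\<close>.\<close>
  finally have "norm (x s - y s) = 0 \<or> d s \<le> 0"
    using norm_ge_zero[of "x s - y s"] by linarith
  then have "d s \<le> 0"
    by (auto simp: d_def)
  then have "norm (x r - y r) \<le> 0"
    using norm_le[OF r] by (meson exp_ge_zero mult_nonpos_nonneg order_trans)
  then show ?thesis
    by simp
qed

section \<open>The flow at small times\<close>

lemma mild_solution_subinterval:
  "mild_solution T f \<tau> u x \<Longrightarrow> t \<le> \<tau> \<Longrightarrow> mild_solution T f t u x"
  unfolding mild_solution_def
  by (meson atLeastAtMost_iff atLeastatMost_subset_iff continuous_on_subset order.refl order.trans)

text \<open>Uniqueness turns the definite description in \<open>flow\<close> into the endpoint of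
  any mild solution at hand.\<close>

lemma flow_eq:
  assumes "mild_solution T f t u x" "0 \<le> t" "t \<le> h" "continuous_on {0..t} u"
  shows "flow T f t (x 0) u = x t"
  unfolding flow_def
proof (rule the_equality)
  show "\<exists>z. mild_solution T f t u z \<and> z 0 = x 0 \<and> z t = x t"
    using assms(1) by auto
next
  fix y assume "\<exists>z. mild_solution T f t u z \<and> z 0 = x 0 \<and> z t = y"
  then obtain z where "mild_solution T f t u z" "z 0 = x 0" "z t = y"
    by auto
  then show "y = x t"
    using mild_solution_unique[of t u z x t] assms by simp
qed

text \<open>Once the free motion is subtracted only the convolution remains, so the limit exists
  even for \<open>x\<^sub>0\<close> outside the domain of the generator.\<close>

lemma flow_quotient_tendsto:
  assumes u: "u \<in> admissible_inputs"
  shows "((\<lambda>t. (flow T f t x\<^sub>0 u - T t x\<^sub>0) /\<^sub>R t) \<longlongrightarrow> f x\<^sub>0 (u 0)) (at_right 0)"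
proof -
  have cu: "continuous_on {0..t} u" for t
    using u by (auto simp: admissible_inputs_def intro: continuous_on_subset)
  obtain \<tau> x where \<tau>: "0 < \<tau>" "\<tau> \<le> h" and x: "mild_solution T f \<tau> u x" and x0: "x 0 = x\<^sub>0"
    using mild_solution_local_existence[OF cu] by blast
  have "continuous_on {0..\<tau>} (\<lambda>s. f (x s) (u s))"
    using x cu by (intro continuous_on_f mild_solution_continuous)
  then have lim: "((\<lambda>t. integral {0..t} (\<lambda>s. T (t - s) (f (x s) (u s))) /\<^sub>R t) \<longlongrightarrow> f x\<^sub>0 (u 0)) (at_right 0)"
    using convolution_quotient_tendsto[OF \<tau>, of "\<lambda>s. f (x s) (u s)"] x0 by simp
  have "flow T f t x\<^sub>0 u - T t x\<^sub>0 = integral {0..t} (\<lambda>s. T (t - s) (f (x s) (u s)))"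
    if "0 < t" "t < \<tau>" for t
  proof -
    have sol: "mild_solution T f t u x"
      using mild_solution_subinterval[OF x] that by simp
    have "flow T f t x\<^sub>0 u = x t"
      using flow_eq[OF sol _ _ cu] that \<tau> by (simp add: x0)
    moreover have "x t = T t x\<^sub>0 + integral {0..t} (\<lambda>s. T (t - s) (f (x s) (u s)))"
      using mild_solutionD[OF sol, of t] that by (simp only: x0) simp
    ultimately show ?thesis
      by (simp only: add_diff_cancel_left')
  qed
  then have "eventually (\<lambda>t. integral {0..t} (\<lambda>s. T (t - s) (f (x s) (u s))) /\<^sub>R t =
      (flow T f t x\<^sub>0 u - T t x\<^sub>0) /\<^sub>R t) (at_right 0)"
    using \<tau> by (auto simp: eventually_at_right_field intro!: exI[of _ \<tau>])
  then show ?thesis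
    using lim by (rule Lim_transform_eventually[rotated])
qed

lemma flow_tendsto:
  assumes u: "u \<in> admissible_inputs"
  shows "((\<lambda>t. flow T f t x u) \<longlongrightarrow> x) (at_right 0)"
proof -
  have "((\<lambda>t. T t x + t *\<^sub>R ((flow T f t x u - T t x) /\<^sub>R t)) \<longlongrightarrow> x + 0 *\<^sub>R f x (u 0)) (at_right 0)"
    by (intro tendsto_intros tendsto_T_0 flow_quotient_tendsto u)
  then have "((\<lambda>t. T t x + t *\<^sub>R ((flow T f t x u - T t x) /\<^sub>R t)) \<longlongrightarrow> x) (at_right 0)"
    by simp
  then show ?thesis
    by (rule Lim_transform_eventually) (auto simp: eventually_at_right_field intro!: exI[of _ 1])
qed

end

section \<open>Lie derivatives\<close>

lemma sector_of_real: "0 < \<theta> \<Longrightarrow> 0 < t \<Longrightarrow> complex_of_real t \<in> sector \<theta>"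
  by (simp add: sector_def)

text \<open>Along the positive real axis the increment is real, so the derivative of
  \<open>S\<close> reduces to \<open>h *\<^sub>R B\<close>; the pair \<open>(x, 0)\<close> and the
  first component lead back to the real space.\<close>

lemma analytic_semigroup_differentiable:
  assumes "analytic_semigroup T" "0 < t"
  obtains a where "((\<lambda>s. T s x) has_vector_derivative a) (at t)"
proof -
  obtain \<theta> S where \<theta>: "0 < \<theta>" and analytic: "operator_analytic_on S (sector \<theta>)"
    and S_T: "\<And>t x y. 0 \<le> t \<Longrightarrow> S (complex_of_real t) (x, y) = (T t x, T t y)"
    using assms(1) unfolding analytic_semigroup_def by blast
  obtain B where B: "(S has_derivative (\<lambda>h. Re h *\<^sub>R B + Im h *\<^sub>R (mult_i o\<^sub>L B))) (at (complex_of_real t))"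
    using analytic sector_of_real[OF \<theta> assms(2)] unfolding operator_analytic_on_def by blast
  have "((\<lambda>s. S (complex_of_real s)) has_derivative (\<lambda>h. h *\<^sub>R B)) (at t)"
    using has_derivative_compose[OF has_derivative_of_real[OF has_derivative_ident] B] by simp
  then have "((\<lambda>s. fst (blinfun_apply (S (complex_of_real s)) (x, 0))) has_vector_derivative fst (blinfun_apply B (x, 0))) (at t)"
    unfolding has_vector_derivative_def
    by (auto intro!: derivative_eq_intros simp: blinfun.scaleR_left)
  then have "((\<lambda>s. T s x) has_vector_derivative fst (blinfun_apply B (x, 0))) (at t)"
    using assms(2) by (rule has_vector_derivative_transform_within) (auto simp: S_T dist_real_def)
  then show ?thesis
    by (rule that)
qed

text \<open>A one-sided chain rule: the value of \<open>z\<close> at 0 does not enter the quotients,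
  so it may be reset to \<open>y\<close>, after which the curve has a right derivative at 0.\<close>

lemma has_derivative_quotient_tendsto:
  fixes V :: "'x::real_normed_vector \<Rightarrow> real"
  assumes V: "(V has_derivative V') (at y)" and z: "((\<lambda>t. (z t - y) /\<^sub>R t) \<longlongrightarrow> b) (at_right 0)"
  shows "((\<lambda>t. 1 / t * (V (z t) - V y)) \<longlongrightarrow> V' b) (at_right 0)"
proof -
  define z0 where "z0 t = (if t = 0 then y else z t)" for t
  have "((\<lambda>t. (z0 t - z0 0) /\<^sub>R (t - 0)) \<longlongrightarrow> b) (at_right 0)"
    using z by (rule Lim_transform_eventually)
      (auto simp: eventually_at_right_field z0_def intro!: exI[of _ 1])
  then have "((\<lambda>t. (z0 t - z0 0 - (t - 0) *\<^sub>R b) /\<^sub>R (t - 0)) \<longlongrightarrow> 0) (at_right 0)"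
    by (rule LIM_zero[THEN Lim_transform_eventually])
       (auto simp: eventually_at_right_field scaleR_diff_right intro!: exI[of _ 1])
  then have "(z0 has_derivative (\<lambda>t. t *\<^sub>R b)) (at_right 0)"
    unfolding has_derivative_within
    by (intro conjI bounded_linear_scaleR_left, elim Lim_transform_eventually)
       (auto simp: eventually_at_right_field algebra_simps divide_inverse intro!: exI[of _ 1])
  moreover have "(V has_derivative V') (at (z0 0))"
    using V by (simp add: z0_def)
  ultimately have "((\<lambda>t. V (z0 t)) has_derivative (\<lambda>t. V' (t *\<^sub>R b))) (at_right 0)"
    by (rule has_derivative_compose)
  moreover have "V' (t *\<^sub>R b) = V' b * t" for t
    using linear_scale[OF has_derivative_linear[OF V]] by simp
  ultimately have "((\<lambda>t. V (z0 t)) has_field_derivative V' b) (at_right 0)"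
    by (simp add: has_field_derivative_def)
  then have "((\<lambda>t. (V (z0 t) - V (z0 0)) / (t - 0)) \<longlongrightarrow> V' b) (at_right 0)"
    by (simp add: has_field_derivative_iff)
  then show ?thesis
    by (rule Lim_transform_eventually)
       (auto simp: eventually_at_right_field z0_def intro!: exI[of _ 1])
qed

lemma const_admissible_input: "(\<lambda>_. v) \<in> admissible_inputs"
  by (simp add: admissible_inputs_def image_constant_conv)

text \<open>This lemma and the next trade the extended real upper limit for eventual inequalities
  between reals, with a slack \<open>e\<close>.\<close>

lemma lie_derivative_leI:
  assumes "\<And>e. 0 < e \<Longrightarrow> eventually (\<lambda>t. 1 / t * (V (flow T f t x u) - V x) \<le> c + e) (at_right 0)"
  shows "lie_derivative T f V u x \<le> ereal c"
proof (rule ereal_le_epsilon2)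
  fix e :: real
  assume "0 < e"
  then show "lie_derivative T f V u x \<le> ereal c + ereal e"
    unfolding lie_derivative_def using assms[of e] by (auto intro!: Limsup_bounded)
qed

lemma lie_derivative_leD:
  assumes "lie_derivative T f V u x \<le> ereal c" "0 < e"
  shows "eventually (\<lambda>t. 1 / t * (V (flow T f t x u) - V x) < c + e) (at_right 0)"
proof -
  have "Limsup (at_right 0) (\<lambda>t. ereal (1 / t * (V (flow T f t x u) - V x))) < ereal (c + e)"
    using assms unfolding lie_derivative_def by (simp add: order_le_less_trans)
  then show ?thesis
    by (auto dest: Limsup_lessD)
qed

context C0_semigroup_near_0
begin

text \<open>By the semigroup law, differentiability of an orbit at a positive time puts its state
  into the domain of the generator, and \<open>a\<close> is the value of the generator
  there.\<close>

lemma quotient_tendsto_of_has_vector_derivative: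
  assumes "((\<lambda>s. T s x) has_vector_derivative a) (at t)" "0 < t"
  shows "((\<lambda>k. (T k (T t x) - T t x) /\<^sub>R k) \<longlongrightarrow> a) (at_right 0)"
proof -
  have "((\<lambda>k. norm (T (t + k) x - T t x - k *\<^sub>R a) / norm k) \<longlongrightarrow> 0) (at 0)"
    using assms(1) by (simp add: has_vector_derivative_def has_derivative_at)
  then have "((\<lambda>k. norm ((T (t + k) x - T t x) /\<^sub>R k - a)) \<longlongrightarrow> 0) (at 0)"
  proof (rule Lim_transform_eventually)
    have "norm (z - k *\<^sub>R a) / norm k = norm (z /\<^sub>R k - a)" if "k \<noteq> 0" for k and z :: 'x
    proof -
      have "z /\<^sub>R k - a = (z - k *\<^sub>R a) /\<^sub>R k"
        using that by (simp add: scaleR_diff_right)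
      then show ?thesis
        by (simp add: divide_inverse)
    qed
    then show "eventually (\<lambda>k. norm (T (t + k) x - T t x - k *\<^sub>R a) / norm k =
        norm ((T (t + k) x - T t x) /\<^sub>R k - a)) (at 0)"
      by (simp add: eventually_at_filter)
  qed
  then have "((\<lambda>k. (T (t + k) x - T t x) /\<^sub>R k) \<longlongrightarrow> a) (at 0)"
    by (rule LIM_zero_cancel[OF tendsto_norm_zero_cancel])
  then have "((\<lambda>k. (T (t + k) x - T t x) /\<^sub>R k) \<longlongrightarrow> a) (at_right 0)"
    by (rule tendsto_within_subset) simp
  then show ?thesis
  proof (rule Lim_transform_eventually)
    have "T (t + k) x = T k (T t x)" if "0 < k" for k
      using T_add[of k t x] assms(2) that by (simp add: add.commute)
    then show "eventually (\<lambda>k. (T (t + k) x - T t x) /\<^sub>R k = (T k (T t x) - T t x) /\<^sub>R k) (at_right 0)"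
      by (auto simp: eventually_at_right_field intro!: exI[of _ 1])
  qed
qed

end

context semilinear_system
begin

text \<open>The increment splits into the free motion, with rate \<open>a\<close>, and the forced
  part, with rate \<open>f y (u 0)\<close>; the upper limit is then a genuine limit.\<close>

lemma lie_derivative_eq:
  assumes V: "(V has_derivative V') (at y)" and u: "u \<in> admissible_inputs"
    and a: "((\<lambda>k. (T k y - y) /\<^sub>R k) \<longlongrightarrow> a) (at_right 0)"
  shows "lie_derivative T f V u y = ereal (V' (a + f y (u 0)))"
proof -
  have "((\<lambda>k. (T k y - y) /\<^sub>R k + (flow T f k y u - T k y) /\<^sub>R k) \<longlongrightarrow> a + f y (u 0)) (at_right 0)"
    by (intro tendsto_add a flow_quotient_tendsto u)
  then have "((\<lambda>k. (flow T f k y u - y) /\<^sub>R k) \<longlongrightarrow> a + f y (u 0)) (at_right 0)"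
    by (simp add: scaleR_diff_right)
  then have "((\<lambda>t. ereal (1 / t * (V (flow T f t y u) - V y))) \<longlongrightarrow> ereal (V' (a + f y (u 0)))) (at_right 0)"
    by (intro tendsto_ereal has_derivative_quotient_tendsto[OF V])
  then show ?thesis
    unfolding lie_derivative_def by (intro lim_imp_Limsup) auto
qed

text \<open>The state \<open>x\<close> need not lie in the domain of the generator. The flow from \<open>x\<close> is therefore
  replaced by the curve \<open>w s = T s (x + s f(x, u(0)))\<close>, which agrees with it up to \<open>o(s)\<close>, is
  differentiable for positive times by analyticity, and takes values in the domain of the
  generator. There the Lie derivative is the classical one and changes with the input by
  \<open>V' (f(w, u(0)) - f(w, 0))\<close>.\<close>

lemma lie_derivative_le_perturbed:
  fixes V :: "'x \<Rightarrow> real" and V' :: "'x \<Rightarrow> 'x \<Rightarrow>\<^sub>L real"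
  assumes analytic: "analytic_semigroup T" and f0: "f 0 0 = 0"
    and V: "\<And>x. (V has_derivative V' x) (at x)"
    and N: "\<And>y. norm y \<le> R \<Longrightarrow> norm (V' y) \<le> N"
    and L: "\<And>y z v. norm y \<le> R \<Longrightarrow> norm z \<le> R \<Longrightarrow> norm (f z v - f y v) \<le> L * norm (z - y)"
    and decay: "\<And>y. lie_derivative T f V (\<lambda>_. 0) y \<le> ereal (- \<eta> (norm y))"
    and pq: "\<And>y v. \<bar>V' y (f 0 v)\<bar> \<le> p (norm y) + q (norm v)"
    and \<eta>: "continuous_on {0..} \<eta>" and p: "continuous_on {0..} p"
    and u: "u \<in> admissible_inputs" and x: "norm x < R"
  shows "lie_derivative T f V u x \<le>
    ereal (- \<eta> (norm x) + 2 * (N * L) * norm x + p (norm x) + q (norm (u 0)))"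
    (is "_ \<le> ereal ?c")
proof (rule lie_derivative_leI)
  fix e :: real
  assume e: "0 < e"
  define v where "v = u 0"
  define g where "g = f x v"
  define w where "w s = T s (x + s *\<^sub>R g)" for s
  have N0: "0 \<le> N"
    using N[of x] x norm_ge_zero order_trans by (metis less_imp_le)
  have w_cont: "continuous_on {0..h} w"
    unfolding w_def[abs_def] by (intro continuous_on_T continuous_intros) auto
  have w_lim: "(w \<longlongrightarrow> x) (at_right 0)"
  proof -
    have "(w \<longlongrightarrow> w 0) (at 0 within {0..h})"
      using w_cont h_pos by (simp add: continuous_on_def)
    then show ?thesis
      using h_pos by (simp add: at_within_Icc_at_right w_def[of 0])
  qed
  have norm_w: "((\<lambda>s. norm (w s)) \<longlongrightarrow> norm x) (at_right 0)"
    by (rule tendsto_norm[OF w_lim])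
  have comp_lim: "((\<lambda>s. k (norm (w s))) \<longlongrightarrow> k (norm x)) (at_right 0)" if "continuous_on {0..} k" for k :: "real \<Rightarrow> real"
    by (rule continuous_on_tendsto_compose[OF that norm_w]) auto
  \<comment> \<open>An upper bound for the derivative of \<open>V\<close> along \<open>w\<close>.
    The second and third terms vanish in the limit: they pay for replacing \<open>T s g\<close> by
    \<open>g\<close> and \<open>f x v\<close> by \<open>f (w s) v\<close>. The term with factor 2
    pays for \<open>f (w s) v - f 0 v\<close> and for \<open>f (w s) 0\<close>.\<close>
  define H where "H s = - \<eta> (norm (w s)) + N * norm (T s g - g) + N * (L * norm (x - w s))
    + 2 * (N * L) * norm (w s) + p (norm (w s)) + q (norm v)" for s
  have "(H \<longlongrightarrow> - \<eta> (norm x) + N * norm (g - g) + N * (L * norm (x - x))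
    + 2 * (N * L) * norm x + p (norm x) + q (norm v)) (at_right 0)"
    unfolding H_def[abs_def] by (intro tendsto_intros comp_lim \<eta> p w_lim tendsto_T_0)
  then have H_lim: "(H \<longlongrightarrow> ?c) (at_right 0)"
    by (simp add: v_def)
  have rate: "\<exists>D. (w has_vector_derivative D) (at \<xi>) \<and> V' (w \<xi>) D \<le> H \<xi>"
    if \<xi>: "0 < \<xi>" and w_R: "norm (w \<xi>) < R" for \<xi>
  proof -
    obtain a where a: "((\<lambda>s. T s x) has_vector_derivative a) (at \<xi>)"
      using analytic_semigroup_differentiable[OF analytic \<xi>] .
    obtain b where b: "((\<lambda>s. T s g) has_vector_derivative b) (at \<xi>)"
      using analytic_semigroup_differentiable[OF analytic \<xi>] .
    define y where "y = w \<xi>"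
    have y: "y = T \<xi> (x + \<xi> *\<^sub>R g)"
      by (simp add: y_def w_def)
    have "((\<lambda>s. T s x + s *\<^sub>R T s g) has_vector_derivative (a + (\<xi> *\<^sub>R b + 1 *\<^sub>R T \<xi> g))) (at \<xi>)"
      by (intro has_vector_derivative_add a has_vector_derivative_scaleR b) (rule DERIV_ident)
    then have w': "(w has_vector_derivative (a + \<xi> *\<^sub>R b + T \<xi> g)) (at \<xi>)"
      by (simp add: w_def[abs_def] blinfun.add_right blinfun.scaleR_right add.assoc)
    \<comment> \<open>Freezing the scalar \<open>\<xi>\<close> gives an orbit of the semigroup,
      whose derivative is the generator applied to \<open>y\<close>; the moving scalar in
      \<open>w\<close> only adds \<open>T \<xi> g\<close>.\<close>
    have "((\<lambda>s. T s x + \<xi> *\<^sub>R T s g) has_vector_derivative (a + \<xi> *\<^sub>R b)) (at \<xi>)"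
      by (intro has_vector_derivative_add a bounded_linear.has_vector_derivative[OF bounded_linear_scaleR_right] b)
    then have "((\<lambda>s. T s (x + \<xi> *\<^sub>R g)) has_vector_derivative (a + \<xi> *\<^sub>R b)) (at \<xi>)"
      by (simp add: blinfun.add_right blinfun.scaleR_right)
    then have "((\<lambda>k. (T k y - y) /\<^sub>R k) \<longlongrightarrow> a + \<xi> *\<^sub>R b) (at_right 0)"
      unfolding y using \<xi> by (rule quotient_tendsto_of_has_vector_derivative)
    then have "lie_derivative T f V (\<lambda>_. 0) y = ereal (V' y (a + \<xi> *\<^sub>R b + f y 0))"
      using lie_derivative_eq[OF V const_admissible_input] by blast
    then have 1: "V' y (a + \<xi> *\<^sub>R b + f y 0) \<le> - \<eta> (norm y)"
      using decay[of y] by simp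
    have yR: "norm y \<le> R" "norm x \<le> R" "norm (0::'x) \<le> R"
      using w_R x norm_ge_zero[of x] unfolding y_def by (auto simp del: norm_ge_zero)
    have V'_le: "V' y z \<le> N * r" "- V' y z \<le> N * r" if "norm z \<le> r" for z r
    proof -
      have "\<bar>V' y z\<bar> \<le> N * r"
        using norm_blinfun[of "V' y" z] mult_mono[OF N[OF yR(1)] that N0 norm_ge_zero] by simp
      then show "V' y z \<le> N * r" "- V' y z \<le> N * r"
        by auto
    qed
    have 2: "V' y (T \<xi> g - g) \<le> N * norm (T \<xi> g - g)"
      by (rule V'_le) simp
    have 3: "V' y (f x v - f y v) \<le> N * (L * norm (x - y))"
      by (intro V'_le L yR)
    have 4: "V' y (f y v - f 0 v) \<le> N * (L * norm y)"
      using V'_le(1)[OF L[OF yR(3,1)], of v] by simp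
    have 5: "- V' y (f y 0) \<le> N * (L * norm y)"
      using V'_le(2)[OF L[OF yR(3,1)], of 0] f0 by simp
    have 6: "V' y (f 0 v) \<le> p (norm y) + q (norm v)"
      using pq[of y v] by simp
    have "a + \<xi> *\<^sub>R b + T \<xi> g = (a + \<xi> *\<^sub>R b + f y 0) + (T \<xi> g - g) + (f x v - f y v)
        + (f y v - f 0 v) + f 0 v - f y 0"
      by (simp add: g_def)
    then have "V' y (a + \<xi> *\<^sub>R b + T \<xi> g) = V' y (a + \<xi> *\<^sub>R b + f y 0) + V' y (T \<xi> g - g)
        + V' y (f x v - f y v) + V' y (f y v - f 0 v) + V' y (f 0 v) - V' y (f y 0)"
      by (simp only: blinfun.add_right blinfun.diff_right)
    also have "\<dots> \<le> H \<xi>"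
      using 1 2 3 4 5 6 unfolding H_def y_def by linarith
    finally show ?thesis
      using w' unfolding y_def by blast
  qed
  \<comment> \<open>Since \<open>g\<close> is the limit of the forced quotient, \<open>w\<close>
    follows the flow up to \<open>o(t)\<close>; \<open>E\<close> bounds the resulting error in the
    quotient of \<open>V\<close>.\<close>
  define E where "E t = N * norm ((flow T f t x u - w t) /\<^sub>R t)" for t
  have "((\<lambda>t. N * norm ((flow T f t x u - T t x) /\<^sub>R t - T t g)) \<longlongrightarrow> N * norm (f x (u 0) - g)) (at_right 0)"
    by (intro tendsto_intros flow_quotient_tendsto u tendsto_T_0)
  then have "((\<lambda>t. N * norm ((flow T f t x u - T t x) /\<^sub>R t - T t g)) \<longlongrightarrow> 0) (at_right 0)"
    by (simp add: g_def v_def)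
  then have E_lim: "(E \<longlongrightarrow> 0) (at_right 0)"
    by (rule Lim_transform_eventually)
       (auto simp: eventually_at_right_field E_def w_def blinfun.add_right blinfun.scaleR_right
         scaleR_diff_right scaleR_add_right diff_diff_add intro!: exI[of _ 1])
  have "eventually (\<lambda>s. norm (w s) < R \<and> H s < ?c + e / 2) (at_right 0)"
    using order_tendstoD(2)[OF norm_w x] order_tendstoD(2)[OF H_lim, of "?c + e / 2"] e
    by (simp add: eventually_conj_iff)
  then obtain d where d: "0 < d" "\<And>s. 0 < s \<Longrightarrow> s < d \<Longrightarrow> norm (w s) < R \<and> H s < ?c + e / 2"
    by (auto simp: eventually_at_right_field)
  have "eventually (\<lambda>t. norm (flow T f t x u) < R) (at_right 0)"
    by (rule order_tendstoD(2)[OF tendsto_norm[OF flow_tendsto[OF u]] x])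
  moreover have "eventually (\<lambda>t. E t < e / 2) (at_right 0)"
    using order_tendstoD(2)[OF E_lim, of "e / 2"] e by simp
  moreover have "eventually (\<lambda>t. t \<in> {0<..<min d h}) (at_right 0)"
    using d h_pos by (intro eventually_at_right_real) auto
  ultimately show "eventually (\<lambda>t. 1 / t * (V (flow T f t x u) - V x) \<le> ?c + e) (at_right 0)"
  proof eventually_elim
    case (elim t)
    then have t: "0 < t" "t < d" "t < h"
      by auto
    have "V (flow T f t x u) - V (w t) \<le> N * norm (flow T f t x u - w t)"
    proof -
      have "norm (V (flow T f t x u) - V (w t)) \<le> N * norm (flow T f t x u - w t)"
      proof (rule differentiable_bound[of "cball 0 R"])
        show "(V has_derivative V' y) (at y within cball 0 R)" for y
          by (rule has_derivative_at_withinI[OF V])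
        show "onorm (V' y) \<le> N" if "y \<in> cball 0 R" for y
          using N[of y] that by (simp add: norm_blinfun.rep_eq)
      qed (use elim d(2)[OF t(1,2)] in auto)
      then show ?thesis
        by simp
    qed
    moreover have "1 / t * (N * norm (flow T f t x u - w t)) = E t"
      using t by (simp add: E_def divide_inverse)
    ultimately have "1 / t * (V (flow T f t x u) - V (w t)) \<le> E t"
      using t by (metis divide_nonneg_pos mult_left_mono zero_le_one)
    then have 1: "1 / t * (V (flow T f t x u) - V (w t)) \<le> e / 2"
      using elim(2) by linarith
    \<comment> \<open>The mean value theorem wants the derivatives as a function of time, hence the
      choice operator.\<close>
    have w_der: "(w has_vector_derivative (SOME D. (w has_vector_derivative D) (at \<xi>) \<and> V' (w \<xi>) D \<le> H \<xi>)) (at \<xi>)"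
      "V' (w \<xi>) (SOME D. (w has_vector_derivative D) (at \<xi>) \<and> V' (w \<xi>) D \<le> H \<xi>) \<le> H \<xi>"
      if "0 < \<xi>" "\<xi> < t" for \<xi>
      using someI_ex[OF rate[of \<xi>]] d(2)[of \<xi>] that t by auto
    define D where "D \<xi> = (SOME D. (w has_vector_derivative D) (at \<xi>) \<and> V' (w \<xi>) D \<le> H \<xi>)" for \<xi>
    have V_w: "((\<lambda>s. V (w s)) has_derivative (\<lambda>k. V' (w \<xi>) (k *\<^sub>R D \<xi>))) (at \<xi>)"
      if "0 < \<xi>" "\<xi> < t" for \<xi>
      using w_der(1)[OF that] V unfolding has_vector_derivative_def D_def
      by (rule has_derivative_compose)
    have "continuous_on {0..t} (\<lambda>s. V (w s))"
    proof (rule continuous_on_compose2[of UNIV V])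
      show "continuous_on UNIV V"
        by (rule has_derivative_continuous_on[OF V])
      show "continuous_on {0..t} w"
        using t by (intro continuous_on_subset[OF w_cont]) auto
    qed simp
    \<comment> \<open>The intermediate time is positive, so \<open>w \<xi>\<close> lies in the
      domain of the generator even if \<open>x\<close> does not.\<close>
    then obtain \<xi> where \<xi>: "0 < \<xi>" "\<xi> < t"
        "V (w t) - V (w 0) = V' (w \<xi>) ((t - 0) *\<^sub>R D \<xi>)"
      by (rule mvt[OF t(1) _ V_w]) auto
    then have "1 / t * (V (w t) - V x) = V' (w \<xi>) (D \<xi>)"
      using t by (simp add: w_def blinfun.scaleR_right)
    also have "\<dots> \<le> H \<xi>"
      unfolding D_def by (rule w_der(2)[OF \<xi>(1,2)])
    also have "\<dots> \<le> ?c + e / 2"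
      using d(2)[of \<xi>] \<xi> t by simp
    finally show ?case
      using 1 unfolding right_diff_distrib by linarith
  qed
qed

end

section \<open>Comparison functions\<close>

lemma continuous_on_half_lineI:
  fixes F :: "real \<Rightarrow> 'a::topological_space"
  assumes "\<And>b. continuous_on {0..b} F"
  shows "continuous_on {0..} F"
  unfolding continuous_on_def
proof
  fix s :: real
  assume s: "s \<in> {0..}"
  have "at s within {0..} = at s within {0..s + 1}"
    by (rule at_within_nhd[of s "{..<s + 1}"]) auto
  then show "(F \<longlongrightarrow> F s) (at s within {0..})"
    using assms[of "s + 1"] s by (simp add: continuous_on_def)
qed

section \<open>Elementary facts on the comparison classes\<close>

lemma class_K_less: "\<gamma> \<in> class_K \<Longrightarrow> 0 \<le> r \<Longrightarrow> r < s \<Longrightarrow> \<gamma> r < \<gamma> s"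
  by (auto simp: class_K_def strict_mono_on_def)

lemma class_K_mono: "\<gamma> \<in> class_K \<Longrightarrow> 0 \<le> r \<Longrightarrow> r \<le> s \<Longrightarrow> \<gamma> r \<le> \<gamma> s"
  using class_K_less[of \<gamma> r s] by (cases "r = s") auto

lemma class_K_le_iff: "\<gamma> \<in> class_K \<Longrightarrow> 0 \<le> r \<Longrightarrow> 0 \<le> s \<Longrightarrow> \<gamma> r \<le> \<gamma> s \<longleftrightarrow> r \<le> s"
  using class_K_less[of \<gamma> s r] class_K_mono[of \<gamma> r s] by force

lemma class_K_less_iff: "\<gamma> \<in> class_K \<Longrightarrow> 0 \<le> r \<Longrightarrow> 0 \<le> s \<Longrightarrow> \<gamma> r < \<gamma> s \<longleftrightarrow> r < s"
  using class_K_le_iff[of \<gamma> s r] by force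

lemma class_K_zero: "\<gamma> \<in> class_K \<Longrightarrow> \<gamma> 0 = 0"
  by (simp add: class_K_def class_P_def)

lemma class_K_nonneg: "\<gamma> \<in> class_K \<Longrightarrow> 0 \<le> r \<Longrightarrow> 0 \<le> \<gamma> r"
  using class_K_mono[of \<gamma> 0 r] by (simp add: class_K_zero)

lemma class_K_continuous: "\<gamma> \<in> class_K \<Longrightarrow> continuous_on {0..} \<gamma>"
  by (simp add: class_K_def class_P_def)

lemma class_KI:
  assumes "continuous_on {0..} \<gamma>" "\<gamma> 0 = 0" and less: "\<And>r s. 0 \<le> r \<Longrightarrow> r < s \<Longrightarrow> \<gamma> r < \<gamma> s"
  shows "\<gamma> \<in> class_K"
  using assms less[of 0] by (auto simp: class_K_def class_P_def strict_mono_on_def)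

lemma class_K_infinity_imp_class_K: "\<gamma> \<in> class_K_infinity \<Longrightarrow> \<gamma> \<in> class_K"
  by (simp add: class_K_infinity_def)

lemma class_K_infinity_unbounded:
  assumes "\<gamma> \<in> class_K_infinity"
  obtains r where "0 \<le> r" "b \<le> \<gamma> r"
proof (rule ccontr)
  assume 1: "\<not> thesis"
  note 2 = that
  then have "\<gamma> r \<le> b" if "0 \<le> r" for r
    using that 1 2 by force
  moreover have "0 \<le> \<gamma> r" if "0 \<le> r" for r
    using class_K_nonneg[OF class_K_infinity_imp_class_K[OF assms] that] .
  ultimately have "bounded (\<gamma> ` {0..})"
    unfolding bounded_iff by (intro exI[of _ b]) auto
  then show False
    using assms by (simp add: class_K_infinity_def)
qed

lemma class_K_infinityI:
  assumes "\<gamma> \<in> class_K" "\<And>b. \<exists>r\<ge>0. b \<le> \<gamma> r"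
  shows "\<gamma> \<in> class_K_infinity"
proof -
  have "\<not> bounded (\<gamma> ` {0..})"
  proof
    assume "bounded (\<gamma> ` {0..})"
    then obtain B where B: "\<And>r. 0 \<le> r \<Longrightarrow> \<bar>\<gamma> r\<bar> \<le> B"
      by (auto simp: bounded_iff)
    obtain r where "0 \<le> r" "B + 1 \<le> \<gamma> r"
      using assms(2) by blast
    then show False
      using B[of r] by linarith
  qed
  then show ?thesis
    using assms(1) by (simp add: class_K_infinity_def)
qed

lemma class_K_infinity_at_top:
  assumes "\<gamma> \<in> class_K_infinity"
  shows "filterlim \<gamma> at_top at_top"
  unfolding filterlim_at_top eventually_at_top_linorder
proof
  fix b
  obtain r where r: "0 \<le> r" "b \<le> \<gamma> r"
    using class_K_infinity_unbounded[OF assms] .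
  have "b \<le> \<gamma> s" if "r \<le> s" for s
    using class_K_mono[OF class_K_infinity_imp_class_K[OF assms] r(1) that] r(2) by simp
  then show "\<exists>r. \<forall>s\<ge>r. b \<le> \<gamma> s"
    by blast
qed

lemma class_K_infinity_comp:
  assumes "\<rho> \<in> class_K_infinity" "\<psi> \<in> class_K_infinity"
  shows "(\<lambda>r. \<rho> (\<psi> r)) \<in> class_K_infinity"
proof (rule class_K_infinityI)
  have K: "\<rho> \<in> class_K" "\<psi> \<in> class_K"
    using assms by (auto intro: class_K_infinity_imp_class_K)
  show "(\<lambda>r. \<rho> (\<psi> r)) \<in> class_K"
  proof (rule class_KI)
    show "continuous_on {0..} (\<lambda>r. \<rho> (\<psi> r))"
      by (rule continuous_on_compose2[OF class_K_continuous[OF K(1)] class_K_continuous[OF K(2)]])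
         (auto intro: class_K_nonneg K)
    show "\<rho> (\<psi> 0) = 0"
      by (simp add: class_K_zero K)
    show "\<rho> (\<psi> r) < \<rho> (\<psi> s)" if "0 \<le> r" "r < s" for r s
      using class_K_nonneg[OF K(2) that(1)] class_K_less[OF K(2) that] by (rule class_K_less[OF K(1)])
  qed
  fix b
  obtain v where v: "0 \<le> v" "b \<le> \<rho> v"
    using class_K_infinity_unbounded[OF assms(1)] .
  obtain r where r: "0 \<le> r" "v \<le> \<psi> r"
    using class_K_infinity_unbounded[OF assms(2)] .
  show "\<exists>r\<ge>0. b \<le> \<rho> (\<psi> r)"
    using v r class_K_mono[OF K(1) v(1) r(2)] by (intro exI[of _ r]) auto
qed

text \<open>The solution is \<sigma> followed by the inverse of \<delta>. Asking only that \<delta>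
  reach the values of \<sigma> admits a bounded \<delta>; the identity as \<sigma> gives
  inverses.\<close>

lemma class_K_solve:
  assumes \<delta>: "\<delta> \<in> class_K" and \<sigma>: "\<sigma> \<in> class_K"
    and range: "\<And>s. 0 \<le> s \<Longrightarrow> \<exists>r\<ge>0. \<sigma> s \<le> \<delta> r"
  obtains \<gamma> where "\<gamma> \<in> class_K" "\<And>s. 0 \<le> s \<Longrightarrow> \<delta> (\<gamma> s) = \<sigma> s"
proof -
  have "\<exists>r\<ge>0. \<delta> r = \<sigma> s" if s: "0 \<le> s" for s
  proof -
    obtain b where "0 \<le> b" "\<sigma> s \<le> \<delta> b"
      using range[OF s] by blast
    then show ?thesis
      using IVT'[of \<delta> 0 "\<sigma> s" b] class_K_nonneg[OF \<sigma> s] class_K_zero[OF \<delta>]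
        continuous_on_subset[OF class_K_continuous[OF \<delta>], of "{0..b}"] by auto
  qed
  then obtain \<gamma> where \<gamma>: "\<And>s. 0 \<le> s \<Longrightarrow> 0 \<le> \<gamma> s" "\<And>s. 0 \<le> s \<Longrightarrow> \<delta> (\<gamma> s) = \<sigma> s"
    by metis
  \<comment> \<open>These equivalences translate order neighbourhoods of \<open>\<gamma> s\<close>
    into those of \<open>\<sigma> s\<close>, so \<gamma> inherits continuity.\<close>
  have less_\<gamma>: "r < \<gamma> s \<longleftrightarrow> \<delta> r < \<sigma> s" and \<gamma>_less: "\<gamma> s < r \<longleftrightarrow> \<sigma> s < \<delta> r"
    if "0 \<le> r" "0 \<le> s" for r s
    using class_K_less_iff[OF \<delta> that(1) \<gamma>(1)[OF that(2)]] class_K_less_iff[OF \<delta> \<gamma>(1)[OF that(2)] that(1)]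
      \<gamma>(2)[OF that(2)] by auto
  have "\<gamma> \<in> class_K"
  proof (rule class_KI)
    show "continuous_on {0..} \<gamma>"
      unfolding continuous_on_def
    proof
      fix s :: real
      assume s: "s \<in> {0..}"
      then have lim: "(\<sigma> \<longlongrightarrow> \<sigma> s) (at s within {0..})"
        using class_K_continuous[OF \<sigma>] by (simp add: continuous_on_def)
      have ev: "eventually (\<lambda>r. 0 \<le> r) (at s within {0..})"
        by (simp add: eventually_at_filter)
      show "(\<gamma> \<longlongrightarrow> \<gamma> s) (at s within {0..})"
      proof (rule order_tendstoI)
        fix a assume a: "a < \<gamma> s"
        show "eventually (\<lambda>r. a < \<gamma> r) (at s within {0..})"
        proof (cases "0 \<le> a")
          case True
          then have "\<delta> a < \<sigma> s"
            using a s less_\<gamma> by simp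
          from order_tendstoD(1)[OF lim this] ev show ?thesis
            by eventually_elim (use True less_\<gamma> in simp)
        next
          case False
          from ev show ?thesis
            by eventually_elim (use False \<gamma>(1) in force)
        qed
      next
        fix b assume b: "\<gamma> s < b"
        then have "0 \<le> b"
          using \<gamma>(1)[of s] s by simp
        then have "\<sigma> s < \<delta> b"
          using b s \<gamma>_less by simp
        from order_tendstoD(2)[OF lim this] ev show "eventually (\<lambda>r. \<gamma> r < b) (at s within {0..})"
          by eventually_elim (use \<open>0 \<le> b\<close> \<gamma>_less in simp)
      qed
    qed
    show "\<gamma> 0 = 0"
      using less_\<gamma>[of 0 0] \<gamma>(1)[of 0] class_K_zero[OF \<delta>] class_K_zero[OF \<sigma>] by simp
    show "\<gamma> r < \<gamma> s" if "0 \<le> r" "r < s" for r s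
      using that \<gamma> less_\<gamma>[of "\<gamma> r" s] class_K_less[OF \<sigma> that] by simp
  qed
  then show ?thesis
    using \<gamma>(2) by (rule that)
qed

text \<open>The infimum over the tail is the largest nondecreasing minorant of \<alpha>. It stays
  positive because the eventual bound \<open>c\<close> leaves only a compact interval, where
  \<alpha> attains a positive minimum.\<close>

lemma class_P_running_infimum:
  assumes \<alpha>: "\<alpha> \<in> class_P" and "0 < c" and ev: "eventually (\<lambda>r. c \<le> \<alpha> r) at_top"
  obtains \<delta> where "continuous_on {0..} \<delta>" "\<delta> 0 = 0" "\<And>r. 0 < r \<Longrightarrow> 0 < \<delta> r"
    "\<And>r s. 0 \<le> r \<Longrightarrow> r \<le> s \<Longrightarrow> \<delta> r \<le> \<delta> s" "\<And>r. 0 \<le> r \<Longrightarrow> \<delta> r \<le> \<alpha> r"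
    "\<And>r b. \<forall>s\<ge>r. b \<le> \<alpha> s \<Longrightarrow> b \<le> \<delta> r"
proof -
  define \<delta> where "\<delta> r = Inf (\<alpha> ` {r..})" for r
  have \<alpha>_cont: "continuous_on {0..} \<alpha>" and \<alpha>_pos: "\<And>r. 0 < r \<Longrightarrow> 0 < \<alpha> r" and \<alpha>_0: "\<alpha> 0 = 0"
    using \<alpha> by (auto simp: class_P_def)
  have \<alpha>_nonneg: "0 \<le> \<alpha> r" if "0 \<le> r" for r
    using \<alpha>_pos[of r] \<alpha>_0 that by (cases "r = 0") simp_all
  have lower: "\<delta> r \<le> \<alpha> s" if "0 \<le> r" "r \<le> s" for r s
    unfolding \<delta>_def
  proof (rule cINF_lower)
    show "bdd_below (\<alpha> ` {r..})"
      by (rule bdd_belowI2[of _ 0]) (use that(1) \<alpha>_nonneg in simp)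
  qed (use that(2) in simp)
  have greatest: "b \<le> \<delta> r" if "\<And>s. r \<le> s \<Longrightarrow> b \<le> \<alpha> s" for r b
    unfolding \<delta>_def by (rule cINF_greatest) (use that in auto)
  have mono: "\<delta> r \<le> \<delta> s" if "0 \<le> r" "r \<le> s" for r s
    by (rule greatest) (use that lower in auto)
  have pos: "0 < \<delta> r" if r: "0 < r" for r
  proof -
    obtain b where b: "\<And>s. b \<le> s \<Longrightarrow> c \<le> \<alpha> s"
      using ev by (auto simp: eventually_at_top_linorder)
    have "continuous_on {r..max r b} \<alpha>"
      using r by (intro continuous_on_subset[OF \<alpha>_cont]) auto
    then obtain m where m: "m \<in> {r..max r b}" "\<And>s. s \<in> {r..max r b} \<Longrightarrow> \<alpha> m \<le> \<alpha> s"
      using continuous_attains_inf[of "{r..max r b}" \<alpha>] by auto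
    have "min c (\<alpha> m) \<le> \<delta> r"
    proof (rule greatest)
      fix s assume "r \<le> s"
      then show "min c (\<alpha> m) \<le> \<alpha> s"
        using b[of s] m(2)[of s] by (cases "s \<le> b") auto
    qed
    then show ?thesis
      using \<open>0 < c\<close> \<alpha>_pos[of m] m(1) r by auto
  qed
  have zero: "\<delta> 0 = 0"
    using lower[of 0 0] greatest[OF \<alpha>_nonneg, of 0] \<alpha>_0 by simp
  have "continuous_on {0..} \<delta>"
    unfolding continuous_on_iff
  proof (intro ballI allI impI)
    fix x e :: real
    assume x: "x \<in> {0..}" and e: "0 < e"
    have "\<exists>d>0. \<forall>y\<in>{0..}. dist y x < d \<longrightarrow> dist (\<alpha> y) (\<alpha> x) < e / 3"
      using continuous_on_iff[THEN iffD1, OF \<alpha>_cont, rule_format, OF x, of "e / 3"] e by simp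
    then obtain d where d: "0 < d" "\<forall>y\<in>{0..}. dist y x < d \<longrightarrow> dist (\<alpha> y) (\<alpha> x) < e / 3"
      by blast
    \<comment> \<open>Moving from \<open>a\<close> to \<open>b\<close> discards only values of
      \<alpha> within \<open>e / 3\<close> of \<open>\<alpha> x\<close>, so the infimum rises by at
      most \<open>2 * e / 3\<close>.\<close>
    have *: "\<delta> b - 2 * e / 3 \<le> \<delta> a"
      if "0 \<le> a" "a \<le> b" "dist a x < d" "dist b x < d" for a b
    proof (rule greatest)
      fix s assume s: "a \<le> s"
      show "\<delta> b - 2 * e / 3 \<le> \<alpha> s"
      proof (cases "b \<le> s")
        case True
        then show ?thesis
          using lower[of b s] that e by auto
      next
        case False
        then have "dist s x < d"
          using that s by (auto simp: dist_real_def)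
        then have "\<alpha> b - 2 * e / 3 \<le> \<alpha> s"
          using d(2)[rule_format, of s] d(2)[rule_format, of b] that s
          unfolding dist_real_def abs_less_iff by simp
        then show ?thesis
          using lower[of b b] that by auto
      qed
    qed
    show "\<exists>d>0. \<forall>y\<in>{0..}. dist y x < d \<longrightarrow> dist (\<delta> y) (\<delta> x) < e"
    proof (intro exI conjI ballI impI)
      fix y assume y: "y \<in> {0..}" "dist y x < d"
      show "dist (\<delta> y) (\<delta> x) < e"
      proof (cases "x \<le> y")
        case True
        then show ?thesis
          using *[of x y] mono[of x y] x y d(1) e by (auto simp: dist_real_def)
      next
        case False
        then show ?thesis
          using *[of y x] mono[of y x] x y d(1) e by (auto simp: dist_real_def)
      qed
    qed (rule d(1))
  qed
  then show ?thesis
    using zero pos mono lower greatest by (intro that[of \<delta>]) auto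
qed

text \<open>Interpolates constants found on balls of integer radius: the \<open>k\<close>-th ramp
  rises from 0 at \<open>k - 2\<close> to 1 at \<open>k - 1\<close>, so near any point the sum is
  finite.\<close>

lemma continuous_mono_majorant:
  fixes c :: "nat \<Rightarrow> real"
  obtains F :: "real \<Rightarrow> real" where "continuous_on {0..} F" "\<And>r. 0 \<le> F r"
    "\<And>r s. r \<le> s \<Longrightarrow> F r \<le> F s" "\<And>r n. 0 \<le> r \<Longrightarrow> real n \<le> r + 1 \<Longrightarrow> c n \<le> F r"
proof -
  define G where "G N r = (\<Sum>k\<le>N. \<bar>c k\<bar> * max 0 (min 1 (r + 2 - real k)))" for N :: nat and r
  define F where "F r = G (nat \<lfloor>r\<rfloor> + 2) r" for r
  \<comment> \<open>Later ramps vanish at \<open>r\<close>, so on a bounded interval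
    \<open>F\<close> agrees with one fixed finite sum.\<close>
  have F_eq: "F r = G N r" if "nat \<lfloor>r\<rfloor> + 2 \<le> N" for N r
    unfolding F_def G_def
  proof (rule sum.mono_neutral_left)
    show "\<forall>k\<in>{..N} - {..nat \<lfloor>r\<rfloor> + 2}. \<bar>c k\<bar> * max 0 (min 1 (r + 2 - real k)) = 0"
    proof
      fix k assume "k \<in> {..N} - {..nat \<lfloor>r\<rfloor> + 2}"
      then have "\<lfloor>r\<rfloor> + 3 \<le> int k"
        by auto
      then have "r + 2 - real k \<le> 0"
        by linarith
      then show "\<bar>c k\<bar> * max 0 (min 1 (r + 2 - real k)) = 0"
        by (simp add: min_def)
    qed
  qed (use that in auto)
  show ?thesis
  proof
    show "continuous_on {0..} F"
    proof (rule continuous_on_half_lineI)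
      fix b :: real
      have "continuous_on {0..b} (G (nat \<lfloor>b\<rfloor> + 2))"
        unfolding G_def[abs_def] by (intro continuous_intros)
      then show "continuous_on {0..b} F"
        by (rule continuous_on_eq) (auto intro!: F_eq[symmetric] nat_mono floor_mono)
    qed
    show "0 \<le> F r" for r
      unfolding F_def G_def by (intro sum_nonneg mult_nonneg_nonneg) auto
    show "F r \<le> F s" if "r \<le> s" for r s
    proof -
      have "F r = G (nat \<lfloor>s\<rfloor> + 2) r"
        using that by (intro F_eq add_right_mono nat_mono floor_mono)
      also have "\<dots> \<le> F s"
        unfolding F_def G_def using that by (intro sum_mono mult_left_mono) auto
      finally show ?thesis .
    qed
    show "c n \<le> F r" if "0 \<le> r" "real n \<le> r + 1" for r n
    proof -
      have "n \<le> nat \<lfloor>r\<rfloor> + 2"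
        using that by linarith
      then have "\<bar>c n\<bar> * max 0 (min 1 (r + 2 - real n)) \<le> F r"
        unfolding F_def G_def by (intro member_le_sum) auto
      moreover have "min 1 (r + 2 - real n) = 1"
        using that by simp
      ultimately show ?thesis
        by simp
    qed
  qed
qed

text \<open>A nondecreasing integrand has a convex primitive, and the second claim is the tangent
  inequality at \<open>b\<close>, on either side of it. The lower bound 1 makes the primitive
  strictly increasing and unbounded.\<close>

lemma integral_in_class_K_infinity:
  fixes \<kappa> :: "real \<Rightarrow> real"
  assumes cont: "continuous_on {0..} \<kappa>" and mono: "\<And>r s. 0 \<le> r \<Longrightarrow> r \<le> s \<Longrightarrow> \<kappa> r \<le> \<kappa> s"
    and ge_1: "\<And>r. 0 \<le> r \<Longrightarrow> 1 \<le> \<kappa> r"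
  shows "(\<lambda>v. integral {0..v} \<kappa>) \<in> class_K_infinity"
    and "0 \<le> a \<Longrightarrow> 0 \<le> b \<Longrightarrow> integral {0..b} \<kappa> - integral {0..a} \<kappa> \<le> \<kappa> b * (b - a)"
proof -
  have int: "\<kappa> integrable_on {a..b}" if "0 \<le> a" for a b
    using that by (intro integrable_continuous_real continuous_on_subset[OF cont]) auto
  have diff: "integral {0..b} \<kappa> - integral {0..a} \<kappa> = integral {a..b} \<kappa>" if "0 \<le> a" "a \<le> b" for a b
    using Henstock_Kurzweil_Integration.integral_combine[OF that int[of 0]] by simp
  have lower: "k * (b - a) \<le> integral {a..b} \<kappa>"
    if "0 \<le> a" "a \<le> b" "\<And>r. r \<in> {a..b} \<Longrightarrow> k \<le> \<kappa> r" for a b k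
    using integral_le[of "\<lambda>_. k" "{a..b}" \<kappa>, OF integrable_const_ivl int[OF that(1)] that(3)] that(2)
    by (simp add: mult.commute)
  have upper: "integral {a..b} \<kappa> \<le> k * (b - a)"
    if "0 \<le> a" "a \<le> b" "\<And>r. r \<in> {a..b} \<Longrightarrow> \<kappa> r \<le> k" for a b k
    using integral_le[of \<kappa> "{a..b}" "\<lambda>_. k", OF int[OF that(1)] integrable_const_ivl that(3)] that(2)
    by (simp add: mult.commute)
  have K: "(\<lambda>v. integral {0..v} \<kappa>) \<in> class_K"
  proof (rule class_KI)
    show "continuous_on {0..} (\<lambda>v. integral {0..v} \<kappa>)"
      by (intro continuous_on_half_lineI indefinite_integral_continuous_1 int) simp
    show "integral {0..r} \<kappa> < integral {0..s} \<kappa>" if "0 \<le> r" "r < s" for r s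
      using diff[of r s] lower[of r s 1] ge_1 that by force
  qed simp
  show "(\<lambda>v. integral {0..v} \<kappa>) \<in> class_K_infinity"
  proof (rule class_K_infinityI[OF K])
    fix b :: real
    show "\<exists>r\<ge>0. b \<le> integral {0..r} \<kappa>"
      using lower[of 0 "\<bar>b\<bar>" 1] ge_1 by (intro exI[of _ "\<bar>b\<bar>"]) auto
  qed
  show "integral {0..b} \<kappa> - integral {0..a} \<kappa> \<le> \<kappa> b * (b - a)" if "0 \<le> a" "0 \<le> b"
  proof (cases "a \<le> b")
    case True
    then show ?thesis
      using diff[of a b] upper[of a b "\<kappa> b"] mono that by simp
  next
    case False
    then show ?thesis
      using diff[of b a] lower[of b a "\<kappa> b"] mono that by (simp add: algebra_simps)
  qed
qed

text \<open>In the extended reals an increasing function converges to its supremum; exhibiting this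
  limit gives \<open>Lim\<close> its value.\<close>

lemma class_K_le_Lim:
  assumes \<sigma>: "\<sigma> \<in> class_K" and "0 \<le> s"
  shows "ereal (\<sigma> s) \<le> Lim at_top (\<lambda>\<tau>. ereal (\<sigma> \<tau>))"
proof -
  define l where "l = (SUP r\<in>{0..}. ereal (\<sigma> r))"
  have le_l: "ereal (\<sigma> r) \<le> l" if "0 \<le> r" for r
    unfolding l_def using that by (intro SUP_upper) auto
  have "((\<lambda>\<tau>. ereal (\<sigma> \<tau>)) \<longlongrightarrow> l) at_top"
  proof (rule order_tendstoI)
    fix a assume "a < l"
    then obtain r where r: "0 \<le> r" "a < ereal (\<sigma> r)"
      unfolding l_def less_SUP_iff by auto
    have "a < ereal (\<sigma> t)" if "r \<le> t" for t
      using r class_K_mono[OF \<sigma> r(1) that] by (meson ereal_less_eq(3) less_le_trans)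
    then show "eventually (\<lambda>t. a < ereal (\<sigma> t)) at_top"
      by (auto simp: eventually_at_top_linorder)
  next
    fix a assume "l < a"
    then show "eventually (\<lambda>t. ereal (\<sigma> t) < a) at_top"
      using le_l by (auto simp: eventually_at_top_linorder intro!: exI[of _ 0] intro: le_less_trans)
  qed
  then have "Lim at_top (\<lambda>\<tau>. ereal (\<sigma> \<tau>)) = l"
    by (intro tendsto_Lim) auto
  then show ?thesis
    using le_l assms(2) by simp
qed

section \<open>Comparison of the two forms\<close>

context semilinear_system
begin

text \<open>The tangent inequality at the moved point bounds quotients of
  \<open>\<rho> (V y)\<close> by those of \<open>V\<close> times a value of \<kappa> that tends to
  \<open>\<kappa> (V x)\<close>.\<close>

lemma lie_derivative_comp_le:
  assumes V: "continuous_on UNIV V" "\<And>x. 0 \<le> V x"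
    and \<kappa>: "continuous_on {0..} \<kappa>" "\<And>r. 0 \<le> r \<Longrightarrow> 0 \<le> \<kappa> r"
    and \<rho>: "\<And>a b. 0 \<le> a \<Longrightarrow> 0 \<le> b \<Longrightarrow> \<rho> b - \<rho> a \<le> \<kappa> b * (b - a)"
    and u: "u \<in> admissible_inputs" and lie: "lie_derivative T f V u x \<le> ereal c"
  shows "lie_derivative T f (\<lambda>y. \<rho> (V y)) u x \<le> ereal (\<kappa> (V x) * c)"
proof (rule lie_derivative_leI)
  fix e :: real
  assume e: "0 < e"
  \<comment> \<open>The added 1 avoids division by zero and makes \<open>\<kappa> (V x) * e'\<close>
    strictly less than \<open>e\<close>, which leaves room for the limit.\<close>
  define e' where "e' = e / (\<kappa> (V x) + 1)"
  have \<kappa>0: "0 \<le> \<kappa> (V x)"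
    using \<kappa>(2) V(2) by blast
  have e': "0 < e'" and "\<kappa> (V x) * e' < e"
    using e \<kappa>0 by (auto simp: e'_def divide_simps)
  then have less: "\<kappa> (V x) * (c + e') < \<kappa> (V x) * c + e"
    by (simp add: distrib_left)
  have "((\<lambda>t. V (flow T f t x u)) \<longlongrightarrow> V x) (at_right 0)"
    by (rule continuous_on_tendsto_compose[OF V(1) flow_tendsto[OF u]]) auto
  then have "((\<lambda>t. \<kappa> (V (flow T f t x u))) \<longlongrightarrow> \<kappa> (V x)) (at_right 0)"
    by (rule continuous_on_tendsto_compose[OF \<kappa>(1)]) (auto simp: V(2))
  then have "((\<lambda>t. \<kappa> (V (flow T f t x u)) * (c + e')) \<longlongrightarrow> \<kappa> (V x) * (c + e')) (at_right 0)"
    by (intro tendsto_intros)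
  from order_tendstoD(2)[OF this less] lie_derivative_leD[OF lie e'] eventually_at_right_less[of 0]
  show "eventually (\<lambda>t. 1 / t * (\<rho> (V (flow T f t x u)) - \<rho> (V x)) \<le> \<kappa> (V x) * c + e) (at_right 0)"
  proof eventually_elim
    case (elim t)
    let ?z = "flow T f t x u"
    have "1 / t * (\<rho> (V ?z) - \<rho> (V x)) \<le> 1 / t * (\<kappa> (V ?z) * (V ?z - V x))"
      using elim(3) \<rho>[of "V x" "V ?z"] V(2) by (intro mult_left_mono) auto
    also have "\<dots> = \<kappa> (V ?z) * (1 / t * (V ?z - V x))"
      by simp
    also have "\<dots> \<le> \<kappa> (V ?z) * (c + e')"
      using elim(2) \<kappa>(2)[of "V ?z"] V(2) by (intro mult_left_mono) auto
    finally show ?case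
      using elim(1) by linarith
  qed
qed

lemma implicative_imp_dissipative:
  fixes V :: "'x \<Rightarrow> real" and V' :: "'x \<Rightarrow> 'x \<Rightarrow>\<^sub>L real"
  assumes analytic: "analytic_semigroup T" and f0: "f 0 0 = 0"
    and V: "\<And>x. (V has_derivative V' x) (at x)"
    and V'_bounded: "\<And>c r. bounded (V' ` cball c r)"
    and p: "p \<in> class_K" and q: "q \<in> class_K_infinity"
    and pq: "\<And>x v. \<bar>V' x (f 0 v)\<bar> \<le> p (norm x) + q (norm v)"
    and implicative: "ISS_Lyapunov_implicative T f V"
  shows "ISS_Lyapunov_dissipative T f V"
proof -
  obtain \<psi>\<^sub>1 \<psi>\<^sub>2 \<eta> \<gamma> where \<psi>: "\<psi>\<^sub>1 \<in> class_K_infinity" "\<psi>\<^sub>2 \<in> class_K_infinity"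
    and \<eta>: "\<eta> \<in> class_K_infinity" and \<gamma>: "\<gamma> \<in> class_K"
    and V_cont: "continuous_on UNIV V" and V_nonneg: "\<forall>x. 0 \<le> V x"
    and V_bounds: "\<forall>x. \<psi>\<^sub>1 (norm x) \<le> V x \<and> V x \<le> \<psi>\<^sub>2 (norm x)"
    and decay: "\<And>x u. u \<in> admissible_inputs \<Longrightarrow> \<gamma> (norm (u 0)) \<le> norm x \<Longrightarrow>
      lie_derivative T f V u x \<le> ereal (- \<eta> (norm x))"
    using implicative unfolding ISS_Lyapunov_implicative_def by blast
  note \<eta>K = class_K_infinity_imp_class_K[OF \<eta>] and qK = class_K_infinity_imp_class_K[OF q]
  \<comment> \<open>The bound on \<open>V'\<close> and the Lipschitz constant depend on the ball, so
    each integer radius gets its own \<open>c\<close>, the product of the two.\<close>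
  have bounds: "\<exists>c\<ge>0. \<forall>x u. norm x < real n \<longrightarrow> u \<in> admissible_inputs \<longrightarrow>
      lie_derivative T f V u x \<le> ereal (- \<eta> (norm x) + 2 * c * norm x + p (norm x) + q (norm (u 0)))" for n :: nat
  proof -
    obtain N where N: "0 < N" "\<And>y. norm y \<le> real n \<Longrightarrow> norm (V' y) \<le> N"
      using V'_bounded[of 0 "real n"] unfolding bounded_pos by auto
    obtain L where L0: "0 < L"
      and L: "\<And>x y v. norm x \<le> real n + 1 \<Longrightarrow> norm y \<le> real n + 1 \<Longrightarrow> norm (f y v - f x v) \<le> L * norm (y - x)"
      by (rule lipschitz_fE[of "real n + 1"]) auto
    have "lie_derivative T f V u x \<le> ereal (- \<eta> (norm x) + 2 * (N * L) * norm x + p (norm x) + q (norm (u 0)))"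
      if "norm x < real n" "u \<in> admissible_inputs" for x u
    proof (rule lie_derivative_le_perturbed[OF analytic f0 V N(2) _ _ pq class_K_continuous[OF \<eta>K]
          class_K_continuous[OF p] that(2,1)])
      show "norm (f z v - f y v) \<le> L * norm (z - y)" if "norm y \<le> real n" "norm z \<le> real n" for y z v
        using L that by simp
      \<comment> \<open>The input 0 meets the implicative condition at every state, since \<gamma>
        vanishes at 0.\<close>
      show "lie_derivative T f V (\<lambda>_. 0) y \<le> ereal (- \<eta> (norm y))" for y
        by (rule decay[OF const_admissible_input]) (simp add: class_K_zero[OF \<gamma>])
    qed
    then show ?thesis
      using N(1) L0 by (intro exI[of _ "N * L"]) auto
  qed
  then have "\<exists>c. \<forall>n. 0 \<le> c n \<and> (\<forall>x u. norm x < real n \<longrightarrow> u \<in> admissible_inputs \<longrightarrow>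
      lie_derivative T f V u x \<le> ereal (- \<eta> (norm x) + 2 * c n * norm x + p (norm x) + q (norm (u 0))))"
    by (intro choice allI)
  then obtain c where c: "\<And>n. 0 \<le> c n" and lie_le: "\<And>n x u. norm x < real n \<Longrightarrow> u \<in> admissible_inputs \<Longrightarrow>
      lie_derivative T f V u x \<le> ereal (- \<eta> (norm x) + 2 * c n * norm x + p (norm x) + q (norm (u 0)))"
    by auto
  obtain F where F: "continuous_on {0..} F" "\<And>r. 0 \<le> F r" "\<And>r s. r \<le> s \<Longrightarrow> F r \<le> F s"
    and c_le_F: "\<And>r n. 0 \<le> r \<Longrightarrow> real n \<le> r + 1 \<Longrightarrow> c n \<le> F r"
    by (rule continuous_mono_majorant[of c]) (rule that; assumption)
  \<comment> \<open>Meant for states of norm below \<open>\<gamma> s\<close>, with \<open>F\<close>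
    dominating the constants \<open>c n\<close>; \<open>q\<close> supplies the strict
    growth.\<close>
  define \<sigma> where "\<sigma> s = 2 * F (\<gamma> s) * \<gamma> s + p (\<gamma> s) + q s" for s
  have \<sigma>: "\<sigma> \<in> class_K"
  proof (rule class_KI)
    have \<gamma>_range: "\<gamma> ` {0..} \<subseteq> {0..}"
      using class_K_nonneg[OF \<gamma>] by auto
    have "continuous_on {0..} (\<lambda>s. F (\<gamma> s))"
      by (rule continuous_on_compose2[OF F(1) class_K_continuous[OF \<gamma>] \<gamma>_range])
    moreover have "continuous_on {0..} (\<lambda>s. p (\<gamma> s))"
      by (rule continuous_on_compose2[OF class_K_continuous[OF p] class_K_continuous[OF \<gamma>] \<gamma>_range])
    ultimately show "continuous_on {0..} \<sigma>"
      unfolding \<sigma>_def[abs_def]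
      by (auto intro!: continuous_intros class_K_continuous[OF \<gamma>] class_K_continuous[OF qK])
    show "\<sigma> 0 = 0"
      by (simp add: \<sigma>_def class_K_zero[OF \<gamma>] class_K_zero[OF p] class_K_zero[OF qK])
    show "\<sigma> r < \<sigma> s" if "0 \<le> r" "r < s" for r s
    proof -
      have "\<gamma> r \<le> \<gamma> s" "0 \<le> \<gamma> r"
        using that class_K_mono[OF \<gamma>, of r s] class_K_nonneg[OF \<gamma>, of r] by auto
      then have "2 * F (\<gamma> r) * \<gamma> r \<le> 2 * F (\<gamma> s) * \<gamma> s" "p (\<gamma> r) \<le> p (\<gamma> s)"
        using F(2,3) by (auto intro!: mult_mono class_K_mono[OF p])
      then show ?thesis
        unfolding \<sigma>_def using class_K_less[OF qK that] by linarith
    qed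
  qed
  have "lie_derivative T f V u x \<le> ereal (- \<eta> (norm x) + \<sigma> (norm (u 0)))"
    if u: "u \<in> admissible_inputs" for x u
  proof (cases "\<gamma> (norm (u 0)) \<le> norm x")
    case True
    have "ereal (- \<eta> (norm x)) \<le> ereal (- \<eta> (norm x) + \<sigma> (norm (u 0)))"
      using class_K_nonneg[OF \<sigma>, of "norm (u 0)"] by simp
    with decay[OF u True] show ?thesis
      by (rule order_trans)
  next
    case False
    define r where "r = \<gamma> (norm (u 0))"
    \<comment> \<open>The least integer above \<open>r\<close>: the ball of radius \<open>n\<close>
      contains \<open>x\<close>, and \<open>real n \<le> r + 1\<close> is what the majorant
      requires.\<close>
    define n where "n = nat \<lfloor>r\<rfloor> + 1"
    have x: "norm x < r"
      using False by (simp add: r_def)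
    then have r0: "0 \<le> r"
      using norm_ge_zero[of x] by linarith
    have n: "r < real n" "real n \<le> r + 1"
      using r0 unfolding n_def by linarith+
    have "2 * c n * norm x \<le> 2 * F r * r"
      using x r0 c[of n] c_le_F[OF r0 n(2)] by (intro mult_mono) auto
    moreover have "p (norm x) \<le> p r"
      using x by (intro class_K_mono[OF p]) auto
    ultimately have "- \<eta> (norm x) + 2 * c n * norm x + p (norm x) + q (norm (u 0))
        \<le> - \<eta> (norm x) + \<sigma> (norm (u 0))"
      unfolding \<sigma>_def r_def by linarith
    then show ?thesis
      using lie_le[OF _ u, of x n] x n(1) by (meson ereal_less_eq(3) less_trans order_trans)
  qed
  moreover have "\<eta> \<in> class_P"
    using \<eta>K by (simp add: class_K_def)
  ultimately show ?thesis
    unfolding ISS_Lyapunov_dissipative_def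
    using V_cont V_nonneg V_bounds \<psi> \<sigma> class_K_infinity_at_top[OF \<eta>] by blast
qed

lemma dissipative_imp_implicative:
  assumes dissipative: "ISS_Lyapunov_dissipative T f V"
  obtains W where "ISS_Lyapunov_implicative T f W"
proof -
  obtain \<psi>\<^sub>1 \<psi>\<^sub>2 \<alpha> \<sigma> where \<psi>: "\<psi>\<^sub>1 \<in> class_K_infinity" "\<psi>\<^sub>2 \<in> class_K_infinity"
    and \<alpha>: "\<alpha> \<in> class_P" and \<sigma>: "\<sigma> \<in> class_K"
    and V_cont: "continuous_on UNIV V" and V_nonneg: "\<And>x. 0 \<le> V x"
    and V_bounds: "\<And>x. \<psi>\<^sub>1 (norm x) \<le> V x" "\<And>x. V x \<le> \<psi>\<^sub>2 (norm x)"
    and lie: "\<And>x u. u \<in> admissible_inputs \<Longrightarrow>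
      lie_derivative T f V u x \<le> ereal (- \<alpha> (norm x) + \<sigma> (norm (u 0)))"
    and growth: "filterlim \<alpha> at_top at_top \<or>
         Liminf at_top (\<lambda>\<tau>. ereal (\<alpha> \<tau>)) \<ge> Lim at_top (\<lambda>\<tau>. ereal (\<sigma> \<tau>))"
    using dissipative unfolding ISS_Lyapunov_dissipative_def by blast
  note \<psi>K = \<psi>[THEN class_K_infinity_imp_class_K]
  \<comment> \<open>In the second growth alternative the strict step from \<open>s\<close> to
    \<open>s + 1\<close> turns the comparison of limits into an eventual inequality.\<close>
  have eventually_\<sigma>: "eventually (\<lambda>\<tau>. \<sigma> s \<le> \<alpha> \<tau>) at_top" if s: "0 \<le> s" for s
    using growth
  proof
    assume "filterlim \<alpha> at_top at_top"
    then show ?thesis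
      by (simp add: filterlim_at_top)
  next
    assume *: "Liminf at_top (\<lambda>\<tau>. ereal (\<alpha> \<tau>)) \<ge> Lim at_top (\<lambda>\<tau>. ereal (\<sigma> \<tau>))"
    have "ereal (\<sigma> s) < ereal (\<sigma> (s + 1))"
      using class_K_less[OF \<sigma> s, of "s + 1"] by simp
    also have "\<dots> \<le> Liminf at_top (\<lambda>\<tau>. ereal (\<alpha> \<tau>))"
      using class_K_le_Lim[OF \<sigma>, of "s + 1"] s * by (meson add_nonneg_nonneg order_trans zero_le_one)
    finally have "eventually (\<lambda>\<tau>. ereal (\<sigma> s) < ereal (\<alpha> \<tau>)) at_top"
      by (rule less_LiminfD)
    then show ?thesis
      by eventually_elim simp
  qed
  have "0 < \<sigma> 1"
    using class_K_less[OF \<sigma>, of 0 1] by (simp add: class_K_zero[OF \<sigma>])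
  then obtain \<delta> where \<delta>_cont: "continuous_on {0..} \<delta>" and \<delta>_0: "\<delta> 0 = 0" and \<delta>_pos: "\<And>r. 0 < r \<Longrightarrow> 0 < \<delta> r"
    and \<delta>_mono: "\<And>r s. 0 \<le> r \<Longrightarrow> r \<le> s \<Longrightarrow> \<delta> r \<le> \<delta> s" and \<delta>_le: "\<And>r. 0 \<le> r \<Longrightarrow> \<delta> r \<le> \<alpha> r"
    and \<delta>_greatest: "\<And>r b. \<forall>s\<ge>r. b \<le> \<alpha> s \<Longrightarrow> b \<le> \<delta> r"
    by (rule class_P_running_infimum[OF \<alpha> _ eventually_\<sigma>[OF zero_le_one]]) (rule that; assumption)
  have \<delta>_nonneg: "0 \<le> \<delta> r" if "0 \<le> r" for r
    using \<delta>_mono[OF _ that] \<delta>_0 by simp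
  \<comment> \<open>The factor \<open>r / (1 + r)\<close> makes \<beta> strictly increasing where
    \<delta> is only nondecreasing; the decay that survives is
    \<open>\<delta> r - \<beta> r = \<delta> r / (1 + r)\<close>.\<close>
  define \<beta> where "\<beta> r = \<delta> r * (r / (1 + r))" for r
  have \<beta>: "\<beta> \<in> class_K"
  proof (rule class_KI)
    show "continuous_on {0..} \<beta>"
      unfolding \<beta>_def[abs_def] by (intro continuous_intros \<delta>_cont) auto
    show "\<beta> r < \<beta> s" if "0 \<le> r" "r < s" for r s
    proof -
      have "r / (1 + r) < s / (1 + s)"
        using that by (simp add: divide_simps algebra_simps)
      then have "\<delta> r * (r / (1 + r)) < \<delta> s * (s / (1 + s))"
        using that by (intro order.strict_trans1[OF mult_right_mono mult_strict_left_mono] \<delta>_mono \<delta>_pos) auto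
      then show ?thesis
        by (simp add: \<beta>_def)
    qed
  qed (simp add: \<beta>_def)
  obtain \<gamma> where \<gamma>: "\<gamma> \<in> class_K" and \<beta>_\<gamma>: "\<And>s. 0 \<le> s \<Longrightarrow> \<beta> (\<gamma> s) = \<sigma> s"
  proof (rule class_K_solve[OF \<beta> \<sigma>])
    fix s :: real
    assume s: "0 \<le> s"
    have less: "\<sigma> s < \<sigma> (s + 1)" and nonneg: "0 \<le> \<sigma> s"
      using class_K_less[OF \<sigma> s, of "s + 1"] class_K_nonneg[OF \<sigma> s] by auto
    obtain b where b: "\<And>\<tau>. b \<le> \<tau> \<Longrightarrow> \<sigma> (s + 1) \<le> \<alpha> \<tau>"
      using eventually_\<sigma>[of "s + 1"] s by (auto simp: eventually_at_top_linorder)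
    \<comment> \<open>The gap between \<open>\<sigma> s\<close> and \<open>\<sigma> (s + 1)\<close>
      absorbs the factor \<open>r / (1 + r)\<close> once \<open>r\<close> exceeds the second entry,
      even when \<alpha> is bounded.\<close>
    define r where "r = max b (\<sigma> s / (\<sigma> (s + 1) - \<sigma> s))"
    have r0: "0 \<le> r"
      using less nonneg by (auto simp: r_def le_max_iff_disj)
    have "\<sigma> s / (\<sigma> (s + 1) - \<sigma> s) \<le> r"
      by (simp add: r_def)
    then have "\<sigma> s * (1 + r) \<le> \<sigma> (s + 1) * r"
      using less by (simp add: field_simps)
    then have "\<sigma> s \<le> \<sigma> (s + 1) * (r / (1 + r))"
      using r0 by (simp add: field_simps)
    also have "\<dots> \<le> \<beta> r"
      unfolding \<beta>_def using r0 b by (intro mult_right_mono \<delta>_greatest) (auto simp: r_def)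
    finally show "\<exists>r\<ge>0. \<sigma> s \<le> \<beta> r"
      using r0 by blast
  qed (rule that)
  have id_K: "(\<lambda>v. v) \<in> class_K"
    by (rule class_KI) auto
  obtain \<zeta> where \<zeta>: "\<zeta> \<in> class_K" and \<psi>_\<zeta>: "\<And>v. 0 \<le> v \<Longrightarrow> \<psi>\<^sub>1 (\<zeta> v) = v"
  proof (rule class_K_solve[OF \<psi>K(1) id_K])
    show "\<exists>r\<ge>0. v \<le> \<psi>\<^sub>1 r" for v
      by (rule class_K_infinity_unbounded[OF \<psi>(1), of v]) blast
  qed (rule that)
  \<comment> \<open>\<zeta> inverts \<open>\<psi>\<^sub>1\<close>, so \<open>\<zeta> (V x)\<close>
    is at least the norm of \<open>x\<close>. One factor of the square cancels the denominator in
    the decay, the other makes the rate unbounded.\<close>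
  define \<kappa> where "\<kappa> v = (1 + \<zeta> v)\<^sup>2" for v
  have \<kappa>: "continuous_on {0..} \<kappa>" "\<And>r s. 0 \<le> r \<Longrightarrow> r \<le> s \<Longrightarrow> \<kappa> r \<le> \<kappa> s" "\<And>r. 0 \<le> r \<Longrightarrow> 1 \<le> \<kappa> r"
    using class_K_continuous[OF \<zeta>] class_K_mono[OF \<zeta>] class_K_nonneg[OF \<zeta>]
    by (auto simp: \<kappa>_def[abs_def] intro!: continuous_intros power_mono one_le_power)
  define \<rho> where "\<rho> v = integral {0..v} \<kappa>" for v
  have \<rho>: "\<rho> \<in> class_K_infinity" and \<rho>_le: "\<And>a b. 0 \<le> a \<Longrightarrow> 0 \<le> b \<Longrightarrow> \<rho> b - \<rho> a \<le> \<kappa> b * (b - a)"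
    unfolding \<rho>_def[abs_def] using integral_in_class_K_infinity[of \<kappa>] \<kappa> by blast+
  note \<rho>K = class_K_infinity_imp_class_K[OF \<rho>]
  define \<eta> where "\<eta> r = \<delta> r * (1 + r)" for r
  have \<eta>: "\<eta> \<in> class_K_infinity"
  proof (rule class_K_infinityI)
    show "\<eta> \<in> class_K"
    proof (rule class_KI)
      show "continuous_on {0..} \<eta>"
        unfolding \<eta>_def[abs_def] by (intro continuous_intros \<delta>_cont)
      show "\<eta> r < \<eta> s" if "0 \<le> r" "r < s" for r s
        unfolding \<eta>_def using that
        by (intro order.strict_trans1[OF mult_right_mono mult_strict_left_mono] \<delta>_mono \<delta>_pos) auto
    qed (simp add: \<eta>_def \<delta>_0)
    fix b :: real
    \<comment> \<open>\<delta> may be bounded, but from 1 on it is at least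
      \<open>\<delta> 1\<close>, so the factor \<open>1 + r\<close> forces growth.\<close>
    define r where "r = max 1 (b / \<delta> 1)"
    have "b \<le> \<delta> 1 * r"
      using \<delta>_pos[of 1] mult_left_mono[of "b / \<delta> 1" r "\<delta> 1"] by (simp add: r_def)
    also have "\<dots> \<le> \<delta> r * (1 + r)"
      using \<delta>_pos[of 1] \<delta>_mono[of 1 r] by (intro mult_mono) (auto simp: r_def)
    finally show "\<exists>r\<ge>0. b \<le> \<eta> r"
      unfolding \<eta>_def by (intro exI[of _ r]) (auto simp: r_def)
  qed
  have decay: "lie_derivative T f (\<lambda>y. \<rho> (V y)) u x \<le> ereal (- \<eta> (norm x))"
    if u: "u \<in> admissible_inputs" and "\<gamma> (norm (u 0)) \<le> norm x" for x u
  proof -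
    let ?r = "norm x"
    have "\<sigma> (norm (u 0)) \<le> \<beta> ?r"
      using class_K_mono[OF \<beta> _ that(2)] class_K_nonneg[OF \<gamma>] \<beta>_\<gamma> by simp
    then have "- \<alpha> ?r + \<sigma> (norm (u 0)) \<le> - \<delta> ?r + \<beta> ?r"
      using \<delta>_le[of ?r] by simp
    also have "\<dots> = - (\<delta> ?r / (1 + ?r))"
    proof -
      have "1 + ?r \<noteq> 0"
        using norm_ge_zero[of x] by linarith
      then show ?thesis
        by (simp add: \<beta>_def field_simps)
    qed
    finally have "lie_derivative T f V u x \<le> ereal (- (\<delta> ?r / (1 + ?r)))"
      using lie[OF u, of x] by (meson ereal_less_eq(3) order_trans)
    then have "lie_derivative T f (\<lambda>y. \<rho> (V y)) u x \<le> ereal (\<kappa> (V x) * - (\<delta> ?r / (1 + ?r)))"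
      using \<kappa>(3) by (intro lie_derivative_comp_le V_cont V_nonneg \<kappa>(1) \<rho>_le u) (auto intro: order_trans[OF zero_le_one])
    also have "\<dots> \<le> ereal (- \<eta> ?r)"
    proof -
      have "?r \<le> \<zeta> (V x)"
        using class_K_le_iff[OF \<psi>K(1), of ?r "\<zeta> (V x)"] V_bounds(1)[of x] \<psi>_\<zeta>[OF V_nonneg[of x]]
          class_K_nonneg[OF \<zeta> V_nonneg[of x]] by simp
      then have "(1 + ?r)\<^sup>2 \<le> \<kappa> (V x)"
        unfolding \<kappa>_def by (intro power_mono) auto
      then have "(1 + ?r)\<^sup>2 * (\<delta> ?r / (1 + ?r)) \<le> \<kappa> (V x) * (\<delta> ?r / (1 + ?r))"
        using \<delta>_nonneg[of ?r] by (intro mult_right_mono) auto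
      moreover have "(1 + ?r)\<^sup>2 * (\<delta> ?r / (1 + ?r)) = \<eta> ?r"
      proof -
        have "1 + ?r \<noteq> 0"
          using norm_ge_zero[of x] by linarith
        then show ?thesis
          by (simp add: \<eta>_def power2_eq_square)
      qed
      ultimately show ?thesis
        by simp
    qed
    finally show ?thesis .
  qed
  have W_cont: "continuous_on UNIV (\<lambda>y. \<rho> (V y))"
    by (rule continuous_on_compose2[OF class_K_continuous[OF \<rho>K] V_cont]) (use V_nonneg in auto)
  have W_nonneg: "0 \<le> \<rho> (V x)" for x
    using class_K_nonneg[OF \<rho>K V_nonneg] .
  have W_bounds: "\<rho> (\<psi>\<^sub>1 (norm x)) \<le> \<rho> (V x)" "\<rho> (V x) \<le> \<rho> (\<psi>\<^sub>2 (norm x))" for x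
    using V_bounds V_nonneg class_K_nonneg[OF \<psi>K(1)] by (auto intro!: class_K_mono[OF \<rho>K])
  have "ISS_Lyapunov_implicative T f (\<lambda>y. \<rho> (V y))"
    unfolding ISS_Lyapunov_implicative_def
    by (intro conjI allI W_cont W_nonneg, rule bexI[of _ "\<lambda>r. \<rho> (\<psi>\<^sub>1 r)"],
        rule bexI[of _ "\<lambda>r. \<rho> (\<psi>\<^sub>2 r)"], rule bexI[of _ \<eta>], rule bexI[of _ \<gamma>])
       (auto intro: W_bounds decay \<eta> \<gamma> class_K_infinity_comp \<rho> \<psi>)
  then show ?thesis
    by (rule that)
qed

end

theorem theorem1:
  fixes D :: "'x::banach set" and A :: "'x \<Rightarrow> 'x"
    and T :: "real \<Rightarrow> 'x \<Rightarrow>\<^sub>L 'x"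
    and f :: "'x \<Rightarrow> 'u::banach \<Rightarrow> 'x"
    and V :: "'x \<Rightarrow> real" and V' :: "'x \<Rightarrow> 'x \<Rightarrow>\<^sub>L real"
  assumes "generates D A T"
    and "f 0 0 = 0"
    and "\<And>x. continuous_on UNIV (f x)"
    and "\<And>x. 0 \<le> V x"
    and "lipschitz_on_bounded_uniformly f"
    and "analytic_semigroup T"
    and "\<And>x. (V has_derivative V' x) (at x)"
    and "\<And>c r. bounded (V' ` cball c r)"
    and "\<exists>p\<in>class_K. \<exists>q\<in>class_K_infinity. \<forall>x v. \<bar>V' x (f 0 v)\<bar> \<le> p (norm x) + q (norm v)"
  shows "(ISS_Lyapunov_implicative T f V \<longrightarrow> ISS_Lyapunov_dissipative T f V) \<and>
    (ISS_Lyapunov_dissipative T f V \<longrightarrow> (\<exists>W. ISS_Lyapunov_implicative T f W))"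
proof -
  have C0: "C0_semigroup T"
    using assms(1) by (simp add: generates_def)
  obtain h M where hM: "0 < h" "1 \<le> M" "\<And>t. 0 \<le> t \<Longrightarrow> t \<le> h \<Longrightarrow> norm (T t) \<le> M"
    by (rule C0_semigroup_locally_bounded[OF C0]) (rule that; assumption)
  interpret semilinear_system T h M f
    by unfold_locales (fact C0 hM assms(3,5))+
  obtain p where p: "p \<in> class_K"
    and ex_q: "\<exists>q\<in>class_K_infinity. \<forall>x v. \<bar>V' x (f 0 v)\<bar> \<le> p (norm x) + q (norm v)"
    using assms(9) by (rule bexE)
  obtain q where q: "q \<in> class_K_infinity"
    and pq: "\<forall>x v. \<bar>V' x (f 0 v)\<bar> \<le> p (norm x) + q (norm v)"
    using ex_q by (rule bexE)
  show ?thesis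
  proof (intro conjI impI)
    show "ISS_Lyapunov_dissipative T f V" if "ISS_Lyapunov_implicative T f V"
      by (rule implicative_imp_dissipative[OF assms(6,2,7,8) p q pq[rule_format] that])
    show "\<exists>W. ISS_Lyapunov_implicative T f W" if "ISS_Lyapunov_dissipative T f V"
      by (rule dissipative_imp_implicative[OF that]) (rule exI)
  qed
qed

end
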